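(* Let $$S(k_1, k_2, \dots, k_{d-1}) = 1+2\sum_{i = 1}^{d-1}(2k_i-2)\quad\text{and}\quad P(k_1, k_2, \dots, k_{d-1}) = \prod_{i = 1}^{d-1}k_i.$$ The number of minimally non-$O(n^{d-1})$ $d$-dimensional 0-1 matrices with first $d-1$ dimensions $k_1 \times k_2 \times \dots \times k_{d-1}$ (and last dimension of arbitrary length) is at most $$\sum_{j = 1}^{S(k_1, \dots, k_{d-1})} \left((j+1)^{P(k_1, \dots, k_{d-1})}-j^{P(k_1, \dots, k_{d-1})}\right)P(k_1, \dots, k_{d-1})^{j-1}.$$
   Context: Here $k_1,\dots,k_{d-1}$ are positive integers. A $d$-dimensional 0-1 matrix $A$ contains a $d$-dimensional 0-1 matrix $Q$ if $A$ has a submatrix (obtained by restricting each of the $d$ coordinates to a subset of its range) of the same dimensions as $Q$ that can be turned into $Q$ by changing any number of $1$-entries to $0$-entries; otherwise $A$ avoids $Q$ (is $Q$-free). $Q'$ is properly contained in $Q$ if $Q$ contains $Q'$ and $Q'\neq Q$. $\operatorname{ex}(n,Q,d)$ is the maximum possible number of $1$-entries in a $Q$-free $d$-dimensional 0-1 matrix of dimensions $n\times n\times\dots\times n$ (taken to be $0$ if no such matrix exists). A $d$-dimensional 0-1 matrix $Q$ is minimally non-$O(n^{d-1})$ if $\operatorname{ex}(n,Q,d)=\omega(n^{d-1})$ but $\operatorname{ex}(n,Q',d)=O(n^{d-1})$ for every $d$-dimensional 0-1 matrix $Q'$ properly contained in $Q$. Asymptotics are for $n\to\infty$ with the forbidden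 matrix and $d$ fixed. *)

theory Defs
  imports Complex_Main "HOL-Library.Landau_Symbols"
begin

text \<open>
  A multidimensional 0-1 matrix is given by the list of its dimensions and the set of
  (0-based) positions of its 1-entries. Under \<open>is_matrix\<close> this representation is unique,
  so equality on the type is equality of matrices.
\<close>

datatype zo_matrix = Zo_Matrix (dims: "nat list") (ones: "nat list set")

definition positions :: "nat list \<Rightarrow> nat list set" where
  "positions ns = {x. length x = length ns \<and> (\<forall>i < length ns. x ! i < ns ! i)}"

definition is_matrix :: "nat \<Rightarrow> zo_matrix \<Rightarrow> bool" where
  "is_matrix d A \<longleftrightarrow>
     length (dims A) = d \<and> (\<forall>n \<in> set (dims A). n > 0) \<and> ones A \<subseteq> positions (dims A)"

text \<open>
  \<open>Cs ! i\<close> is the set of values to which the \<open>i\<close>-th coordinate is restricted; the entry at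
  position \<open>x\<close> of the submatrix is the entry of \<open>A\<close> whose \<open>i\<close>-th coordinate is the
  \<open>x ! i\<close>-th smallest element of \<open>Cs ! i\<close>.
\<close>

definition submatrix :: "zo_matrix \<Rightarrow> nat set list \<Rightarrow> zo_matrix" where
  "submatrix A Cs =
     Zo_Matrix (map card Cs)
       {x \<in> positions (map card Cs). map2 (\<lambda>C j. sorted_list_of_set C ! j) Cs x \<in> ones A}"

definition contains :: "zo_matrix \<Rightarrow> zo_matrix \<Rightarrow> bool" where
  "contains A Q \<longleftrightarrow>
     (\<exists>Cs. length Cs = length (dims A) \<and> (\<forall>i < length Cs. Cs ! i \<subseteq> {..<dims A ! i}) \<and>
           dims (submatrix A Cs) = dims Q \<and> ones Q \<subseteq> ones (submatrix A Cs))"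

definition free_weights :: "nat \<Rightarrow> zo_matrix \<Rightarrow> nat \<Rightarrow> nat set" where
  "free_weights n Q d =
     {card (ones A) | A. is_matrix d A \<and> dims A = replicate d n \<and> \<not> contains A Q}"

definition ex_num :: "nat \<Rightarrow> zo_matrix \<Rightarrow> nat \<Rightarrow> nat" where
  "ex_num n Q d = (if free_weights n Q d = {} then 0 else Max (free_weights n Q d))"

definition minimally_non_O :: "nat \<Rightarrow> zo_matrix \<Rightarrow> bool" where
  "minimally_non_O d Q \<longleftrightarrow>
     is_matrix d Q \<and>
     (\<lambda>n. real (ex_num n Q d)) \<in> \<omega>(\<lambda>n. real n ^ (d - 1)) \<and>
     (\<forall>Q'. is_matrix d Q' \<and> contains Q Q' \<and> Q' \<noteq> Q \<longrightarrow>
           (\<lambda>n. real (ex_num n Q' d)) \<in> O(\<lambda>n. real n ^ (d - 1)))"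

definition S :: "nat list \<Rightarrow> nat" where
  "S ks = 1 + 2 * (\<Sum>i<length ks. 2 * ks ! i - 2)"

definition P :: "nat list \<Rightarrow> nat" where
  "P ks = (\<Prod>i<length ks. ks ! i)"

end

theory Submission
  imports Defs "HOL-Library.FuncSet"
begin

text \<open>
  In a minimal matrix no slice (in the last direction) is empty, and a slice with a single one
  cannot lie between two slices having a one on the same line, since deleting such a slice changes
  the extremal function by at most a constant factor and \<open>O(n^(d-1))\<close>. Projecting to one of the
  first coordinates and the last one shows that a pattern is not \<open>O(n^(d-1))\<close> as soon as the
  projection is a nonlinear two-dimensional pattern. The ones used here have four ones: those
  with two rows meeting in an outermost column (avoided by the matrix of the pairs
  \<open>(a, a + 2^k)\<close>), and the alternation \<open>abab\<close> (avoided by superlinear matrices built by the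
  recursion of Hart and Sharir for Davenport--Schinzel sequences of order three). By minimality, a
  matrix with more than four ones contains none of them.

  Alternation-freeness bounds the number of slices, as in the proof that Davenport--Schinzel
  sequences of order two are linear. The other patterns show that each slice contains at most one
  one which is not the first on its line. So the matrix is determined by the place of the first
  one on each line and one further line for each slice but the first.
\<close>

section \<open>Containment as embedding\<close>

text \<open>Slices are deleted by thinning: every \<open>Q\<close>-free host keeps a constant
  fraction of its ones, up to \<open>O(n^(d-1))\<close>, chosen so that a copy of the smaller
  pattern among the kept ones leaves a place, in the full host, for the deleted slice. Conversely, a
  planar set lifts to the positions whose coordinates \<open>i\<close> and \<open>d - 1\<close> form
  a pair of it. This multiplies its size by \<open>n^(d-2)\<close>, so superlinear planar hosts
  refute \<open>O(n^(d-1))\<close>. A matrix consisting only of one of the four-one patterns is not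
  refuted by this argument. Such exceptions have at most four slices, while \<open>S ks\<close> is
  then at least five, and some of them need separate codes. In \<open>S\<close>, a coordinate with
  \<open>k\<close> values and no alternation changes at most \<open>2 * k - 2\<close> times, and of
  two consecutive steps at least one changes some coordinate. In the summand for \<open>j\<close>,
  the first one of a line has \<open>j\<close> places or is missing, hence \<open>j + 1\<close>
  choices; the \<open>j ^ P ks\<close> choices in which no line starts in the first slice are
  subtracted.\<close>

definition embeds :: "(nat \<Rightarrow> nat \<Rightarrow> nat) \<Rightarrow> zo_matrix \<Rightarrow> zo_matrix \<Rightarrow> bool" where
  "embeds e A Q \<longleftrightarrow>
     (\<forall>i<length (dims Q). strict_mono_on {..<dims Q ! i} (e i) \<and>
        e i ` {..<dims Q ! i} \<subseteq> {..<dims A ! i}) \<and>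
     (\<forall>x\<in>ones Q. map2 e [0..<length x] x \<in> ones A)"

lemma embedsD:
  assumes "embeds e A Q" "i < length (dims Q)"
  shows "strict_mono_on {..<dims Q ! i} (e i)" "e i ` {..<dims Q ! i} \<subseteq> {..<dims A ! i}"
  using assms by (simp_all add: embeds_def)

lemma map2_upt_snoc [simp]:
  "map2 e [0..<length (r @ [c])] (r @ [c]) = map2 e [0..<length r] r @ [e (length r) c]"
  by simp

lemma sorted_list_of_set_image_nth:
  assumes "strict_mono_on {..<k} (f :: nat \<Rightarrow> nat)" "j < k"
  shows "sorted_list_of_set (f ` {..<k}) ! j = f j"
proof -
  have "sorted_list_of_set (f ` {..<k}) = map f [0..<k]"
  proof (rule sorted_distinct_set_unique)
    show "sorted (map f [0..<k])"
      unfolding sorted_iff_nth_mono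
      using assms(1) by (auto simp: strict_mono_on_def le_less)
    show "distinct (map f [0..<k])"
      using strict_mono_on_imp_inj_on[OF assms(1)] by (simp add: distinct_map atLeast0LessThan)
  qed (auto simp: atLeast0LessThan)
  then show ?thesis using assms(2) by simp
qed

text \<open>An index set corresponds to its increasing enumeration. Working with maps allows a copy
  to be altered on the last axis alone, which is how slices are inserted.\<close>

lemma contains_iff_embeds:
  assumes len: "length (dims A) = length (dims Q)" and Q: "ones Q \<subseteq> positions (dims Q)"
  shows "contains A Q \<longleftrightarrow> (\<exists>e. embeds e A Q)"
proof
  assume "contains A Q"
  then obtain Cs where Cs: "length Cs = length (dims A)"
    "\<And>i. i < length Cs \<Longrightarrow> Cs ! i \<subseteq> {..<dims A ! i}"
    "map card Cs = dims Q" "ones Q \<subseteq> ones (submatrix A Cs)"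
    unfolding contains_def by (auto simp: submatrix_def)
  define e where "e i = (\<lambda>j. sorted_list_of_set (Cs ! i) ! j)" for i
  have fin: "finite (Cs ! i)" if "i < length Cs" for i
    using Cs(2)[OF that] finite_subset by blast
  have card: "card (Cs ! i) = dims Q ! i" if "i < length Cs" for i
    using Cs(3) that by (metis nth_map)
  have "embeds e A Q"
    unfolding embeds_def
  proof (intro conjI allI impI ballI)
    fix i assume i: "i < length (dims Q)"
    then have i': "i < length Cs" using Cs len by simp
    show "strict_mono_on {..<dims Q ! i} (e i)"
      unfolding strict_mono_on_def e_def
      using sorted_wrt_nth_less[OF strict_sorted_list_of_set, of _ _ "Cs ! i"] card[OF i'] by simp
    show "e i ` {..<dims Q ! i} \<subseteq> {..<dims A ! i}"
      using Cs(2)[OF i'] card[OF i'] fin[OF i'] nth_mem[of _ "sorted_list_of_set (Cs ! i)"]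
      by (force simp: e_def)
  next
    fix x assume x: "x \<in> ones Q"
    then have lx: "length x = length Cs" using Q Cs len by (auto simp: positions_def)
    have "map2 (\<lambda>C j. sorted_list_of_set C ! j) Cs x \<in> ones A"
      using Cs(4) x by (auto simp: submatrix_def)
    also have "map2 (\<lambda>C j. sorted_list_of_set C ! j) Cs x = map2 e [0..<length x] x"
      by (rule nth_equalityI) (auto simp: lx e_def)
    finally show "map2 e [0..<length x] x \<in> ones A" .
  qed
  then show "\<exists>e. embeds e A Q" by blast
next
  assume "\<exists>e. embeds e A Q"
  then obtain e where e: "embeds e A Q" by blast
  define Cs where "Cs = map (\<lambda>i. e i ` {..<dims Q ! i}) [0..<length (dims Q)]"
  have sm: "strict_mono_on {..<dims Q ! i} (e i)" if "i < length (dims Q)" for i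
    using e that by (auto simp: embeds_def)
  have c: "map card Cs = dims Q"
    by (rule nth_equalityI) (auto simp: Cs_def card_image strict_mono_on_imp_inj_on[OF sm])
  have "ones Q \<subseteq> ones (submatrix A Cs)"
  proof
    fix x assume x: "x \<in> ones Q"
    then have p: "x \<in> positions (dims Q)" using Q by auto
    then have lx: "length x = length (dims Q)" by (simp add: positions_def)
    have "map2 (\<lambda>C j. sorted_list_of_set C ! j) Cs x = map2 e [0..<length x] x"
      using p by (intro nth_equalityI)
        (auto simp: Cs_def lx positions_def intro!: sorted_list_of_set_image_nth sm)
    also have "\<dots> \<in> ones A" using e x by (simp add: embeds_def)
    finally show "x \<in> ones (submatrix A Cs)" using p c by (simp add: submatrix_def)
  qed
  moreover have "Cs ! i \<subseteq> {..<dims A ! i}" if "i < length Cs" for i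
    using e that by (auto simp: embeds_def Cs_def)
  ultimately show "contains A Q"
    unfolding contains_def
    by (intro exI[of _ Cs]) (auto simp: c submatrix_def len, simp add: Cs_def)
qed

section \<open>Positions and the extremal function\<close>

lemma positions_Nil [simp]: "positions [] = {[]}"
  by (auto simp: positions_def)

lemma snoc_in_positions [simp]:
  "length r = length ks \<Longrightarrow> r @ [c] \<in> positions (ks @ [j]) \<longleftrightarrow> r \<in> positions ks \<and> c < j"
  by (auto simp: positions_def nth_append less_Suc_eq)

lemma length_positions: "x \<in> positions ns \<Longrightarrow> length x = length ns"
  by (simp add: positions_def)

lemma positions_snoc:
  "positions (ks @ [j]) = (\<lambda>(r, c). r @ [c]) ` (positions ks \<times> {..<j})"
proof (intro equalityI subsetI)
  fix x assume x: "x \<in> positions (ks @ [j])"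
  then obtain r c where "x = r @ [c]"
    by (cases x rule: rev_cases) (auto simp: positions_def)
  moreover from this have "length r = length ks" using x by (simp add: positions_def)
  ultimately show "x \<in> (\<lambda>(r, c). r @ [c]) ` (positions ks \<times> {..<j})"
    using x by auto
qed (auto simp: length_positions)

lemma positions_snocE:
  assumes "x \<in> positions (ks @ [j])"
  obtains r c where "x = r @ [c]" "r \<in> positions ks" "c < j"
  using assms by (auto simp: positions_snoc)

lemma snoc_in_positionsD:
  assumes "X \<subseteq> positions (ks @ [j])" "r @ [c] \<in> X"
  shows "r \<in> positions ks" "c < j" "length r = length ks"
  using assms positions_snocE[of "r @ [c]" ks j] by (auto dest: length_positions)

lemma finite_card_positions:
  "finite (positions ns) \<and> card (positions ns) = (\<Prod>i<length ns. ns ! i)"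
proof (induction ns rule: rev_induct)
  case (snoc n ns)
  have "inj_on (\<lambda>(r, c :: nat). r @ [c]) X" for X by (auto simp: inj_on_def)
  then show ?case using snoc
    by (simp add: positions_snoc card_image card_cartesian_product nth_append lessThan_Suc mult.commute)
qed simp

lemmas finite_positions [simp] = finite_card_positions[THEN conjunct1]
lemmas card_positions = finite_card_positions[THEN conjunct2]

lemma card_positions_replicate: "card (positions (replicate d n)) = n ^ d"
  by (simp add: card_positions)

lemma finite_free_weights [simp]: "finite (free_weights n Q d)"
proof (rule finite_subset)
  show "free_weights n Q d \<subseteq> {..n ^ d}"
    using card_mono[OF finite_positions, of _ "replicate d n"]
    by (auto simp: free_weights_def is_matrix_def card_positions_replicate)
qed simp

lemma ex_num_ge:
  assumes "is_matrix d A" "dims A = replicate d n" "\<not> contains A Q"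
  shows "card (ones A) \<le> ex_num n Q d"
proof -
  have "card (ones A) \<in> free_weights n Q d" using assms by (auto simp: free_weights_def)
  then show ?thesis by (auto simp: ex_num_def)
qed

lemma ex_num_attained:
  assumes "ex_num n Q d \<noteq> 0"
  obtains A where "is_matrix d A" "dims A = replicate d n" "\<not> contains A Q"
    "card (ones A) = ex_num n Q d"
proof -
  have "ex_num n Q d \<in> free_weights n Q d"
    using assms by (auto simp: ex_num_def split: if_splits)
  then show ?thesis using that by (auto simp: free_weights_def)
qed

lemma embeds_id:
  assumes "dims Q' = dims Q" "ones Q' \<subseteq> ones Q"
  shows "embeds (\<lambda>_ j. j) Q Q'"
proof -
  have "map2 (\<lambda>_ j. j) [0..<length x] x = x" for x :: "nat list"
    by (rule nth_equalityI) auto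
  then show ?thesis using assms by (auto simp: embeds_def strict_mono_on_def)
qed

lemma minimally_non_O_not_bigo:
  assumes "minimally_non_O d Q"
  shows "(\<lambda>n. real (ex_num n Q d)) \<notin> O(\<lambda>n. real n ^ (d - 1))"
proof
  assume "(\<lambda>n. real (ex_num n Q d)) \<in> O(\<lambda>n. real n ^ (d - 1))"
  moreover have "(\<lambda>n. real (ex_num n Q d)) \<in> \<omega>(\<lambda>n. real n ^ (d - 1))"
    using assms by (simp add: minimally_non_O_def)
  ultimately have "(\<lambda>n. real n ^ (d - 1)) \<in> o(\<lambda>n. real n ^ (d - 1))"
    using landau_o.small_big_trans[of "\<lambda>n. real n ^ (d - 1)"]
    by (simp add: smallomega_iff_smallo)
  then have "\<forall>\<^sub>F n in sequentially. real n ^ (d - 1) = 0"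
    by (simp add: landau_o.small_refl_iff)
  then have "\<forall>\<^sub>F n :: nat in sequentially. False"
    using eventually_gt_at_top[of "0::nat"] by eventually_elim simp
  then show False by simp
qed

text \<open>Minimal matrices form an antichain under containment; this separates their codes in the
  final count.\<close>

lemma not_minimally_non_O_of_contained:
  assumes "minimally_non_O d Q" "is_matrix d Q'" "contains Q Q'" "Q' \<noteq> Q"
  shows "\<not> minimally_non_O d Q'"
  using assms minimally_non_O_not_bigo[of d Q'] by (auto simp: minimally_non_O_def)

text \<open>An optimal \<open>Q\<close>-free host is turned into a \<open>Q'\<close>-free one. A
  factor \<open>K\<close> and an additive \<open>K * n ^ (d - 1)\<close> are absorbed by
  \<open>O\<close>, so \<open>red\<close> may lose that much.\<close>

lemma bigo_ex_num_transfer: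
  assumes red: "\<And>n A. is_matrix d A \<Longrightarrow> dims A = replicate d n \<Longrightarrow> \<not> contains A Q \<Longrightarrow>
      \<exists>A'. is_matrix d A' \<and> dims A' = replicate d n \<and> \<not> contains A' Q' \<and>
           card (ones A) \<le> K * card (ones A') + K * n ^ (d - 1)"
    and Q': "(\<lambda>n. real (ex_num n Q' d)) \<in> O(\<lambda>n. real n ^ (d - 1))"
  shows "(\<lambda>n. real (ex_num n Q d)) \<in> O(\<lambda>n. real n ^ (d - 1))"
proof -
  have le: "ex_num n Q d \<le> K * ex_num n Q' d + K * n ^ (d - 1)" for n
  proof (cases "ex_num n Q d = 0")
    case False
    then obtain A where A: "is_matrix d A" "dims A = replicate d n" "\<not> contains A Q"
      "card (ones A) = ex_num n Q d"
      using ex_num_attained by metis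
    obtain A' where "is_matrix d A'" "dims A' = replicate d n" "\<not> contains A' Q'"
      "card (ones A) \<le> K * card (ones A') + K * n ^ (d - 1)"
      using red[OF A(1-3)] by blast
    then show ?thesis
      using mult_le_mono2[OF ex_num_ge[of d A' n Q'], of K] A(4) by linarith
  qed simp
  have "(\<lambda>n. real (ex_num n Q d)) \<in>
      O(\<lambda>n. real K * real (ex_num n Q' d) + real K * real n ^ (d - 1))"
  proof (rule landau_o.big_mono, rule always_eventually, rule allI)
    fix n
    have "real (ex_num n Q d) \<le> real (K * ex_num n Q' d + K * n ^ (d - 1))"
      using le[of n] of_nat_le_iff by blast
    then show "norm (real (ex_num n Q d))
        \<le> norm (real K * real (ex_num n Q' d) + real K * real n ^ (d - 1))" by simp
  qed
  also have "(\<lambda>n. real K * real (ex_num n Q' d) + real K * real n ^ (d - 1)) \<in> O(\<lambda>n. real n ^ (d - 1))"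
    using Q' by (intro sum_in_bigo) simp_all
  finally show ?thesis .
qed

section \<open>Deleting a slice\<close>

definition delete_slice :: "nat \<Rightarrow> zo_matrix \<Rightarrow> zo_matrix" where
  "delete_slice c Q =
     Zo_Matrix (butlast (dims Q) @ [last (dims Q) - 1])
       {x. x \<noteq> [] \<and> butlast x @ [if last x < c then last x else Suc (last x)] \<in> ones Q}"

lemma snoc_in_delete_slice [simp]:
  "r @ [x] \<in> ones (delete_slice c Q) \<longleftrightarrow> r @ [if x < c then x else Suc x] \<in> ones Q"
  by (simp add: delete_slice_def)

lemma dims_delete_slice [simp]:
  "dims Q = ks @ [Suc j] \<Longrightarrow> dims (delete_slice c Q) = ks @ [j]"
  by (simp add: delete_slice_def)

lemma is_matrix_snoc:
  "dims Q = ks @ [j] \<Longrightarrow> is_matrix d Q \<longleftrightarrow>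
     Suc (length ks) = d \<and> (\<forall>k\<in>set ks. 0 < k) \<and> 0 < j \<and> ones Q \<subseteq> positions (ks @ [j])"
  by (auto simp: is_matrix_def)

lemma is_matrix_delete_slice:
  assumes "is_matrix d Q" "dims Q = ks @ [Suc j]" "c \<le> j" "0 < j"
  shows "is_matrix d (delete_slice c Q)"
proof -
  have "x \<in> positions (ks @ [j])" if x: "x \<in> ones (delete_slice c Q)" for x
  proof -
    obtain r y where [simp]: "x = r @ [y]"
      using x by (cases x rule: rev_cases) (auto simp: delete_slice_def)
    have "r @ [if y < c then y else Suc y] \<in> positions (ks @ [Suc j])"
      using x assms by (auto simp: is_matrix_snoc split: if_splits)
    moreover from this have "length r = length ks" by (auto dest: length_positions)
    ultimately show ?thesis using assms(3) by (auto split: if_splits)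
  qed
  then show ?thesis using assms by (auto simp: is_matrix_snoc)
qed

lemma embeds_delete_slice:
  assumes Q: "dims Q = ks @ [Suc j]" "ones Q \<subseteq> positions (ks @ [Suc j])" and c: "c \<le> j"
  shows "embeds (\<lambda>i x. if i = length ks \<and> c \<le> x then Suc x else x) Q (delete_slice c Q)"
    (is "embeds ?e _ _")
  unfolding embeds_def
proof (intro conjI allI impI ballI)
  fix x assume "x \<in> ones (delete_slice c Q)"
  moreover from this obtain r y where x: "x = r @ [y]"
    by (cases x rule: rev_cases) (auto simp: delete_slice_def)
  ultimately have y: "r @ [if y < c then y else Suc y] \<in> ones Q" by simp
  then have "length r = length ks" using length_positions Q by fastforce
  moreover from this have "map2 ?e [0..<length r] r = r"
    by (intro nth_equalityI) auto
  ultimately show "map2 ?e [0..<length x] x \<in> ones Q"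
    using y unfolding x map2_upt_snoc by (auto split: if_splits)
qed (use assms in \<open>auto simp: strict_mono_on_def nth_append\<close>)

text \<open>Only the axis maps before the last are taken over from the copy of \<open>Q'\<close>, so
  \<open>Q\<close> and \<open>Q'\<close> may differ in their number of slices.\<close>

lemma contains_change_last:
  assumes Q: "dims Q = ks @ [J]" "ones Q \<subseteq> positions (ks @ [J])"
    and A: "dims A = replicate (Suc (length ks)) n" "dims A' = dims A"
    and e: "embeds e A' Q'" "dims Q' = ks @ [j]"
    and g: "strict_mono_on {..<J} g" "g ` {..<J} \<subseteq> {..<n}"
    and new: "\<And>r y. r @ [y] \<in> ones Q \<Longrightarrow> map2 e [0..<length r] r @ [g y] \<in> ones A"
  shows "contains A Q"
proof -
  let ?m = "length ks"
  define e' where "e' i = (if i = ?m then g else e i)" for i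
  have mono: "strict_mono_on {..<ks ! i} (e i)"
    and bound: "e i ` {..<ks ! i} \<subseteq> {..<n}" if "i < ?m" for i
    using embedsD[OF e(1), of i] that A e(2) by (simp_all add: nth_append del: replicate_Suc)
  have "map2 e' [0..<length x] x \<in> ones A" if x: "x \<in> ones Q" for x
  proof -
    obtain r y where ry: "x = r @ [y]" "r \<in> positions ks" "y < J"
      using x Q(2) positions_snocE by blast
    then have r: "length r = ?m" by (simp add: positions_def)
    then have m: "map2 e' [0..<length r] r = map2 e [0..<length r] r"
      by (intro nth_equalityI) (auto simp: e'_def)
    show ?thesis
      using new[of r y] x unfolding ry(1) map2_upt_snoc m by (simp add: e'_def r)
  qed
  moreover have "strict_mono_on {..<dims Q ! i} (e' i) \<and> e' i ` {..<dims Q ! i} \<subseteq> {..<dims A ! i}"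
    if "i < length (dims Q)" for i
    using that mono[of i] bound[of i] g A(1) Q(1)
    by (cases "i = ?m") (simp_all add: e'_def nth_append less_Suc_eq del: replicate_Suc)
  ultimately have "embeds e' A Q" by (simp add: embeds_def)
  then show ?thesis
    using contains_iff_embeds[of A Q] A(1) Q by auto
qed

text \<open>Slice \<open>c\<close> of the smaller pattern is slice \<open>Suc c\<close> of
  \<open>Q\<close>, so \<open>lo\<close> and \<open>hi\<close> place \<open>C\<close> strictly
  between the images of the two neighbours of the deleted slice; at either end of \<open>Q\<close>
  one of the two conditions is void.\<close>

lemma contains_insert_slice:
  assumes Q: "dims Q = ks @ [Suc j]" "ones Q \<subseteq> positions (ks @ [Suc j])" and c: "c \<le> j"
    and A: "dims A = replicate (Suc (length ks)) n" "ones A' \<subseteq> ones A" "dims A' = dims A"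
    and e: "embeds e A' (delete_slice c Q)" and C: "C < n"
    and lo: "0 < c \<Longrightarrow> e (length ks) (c - 1) < C" and hi: "c < j \<Longrightarrow> C < e (length ks) c"
    and new: "\<And>r. r @ [c] \<in> ones Q \<Longrightarrow> map2 e [0..<length r] r @ [C] \<in> ones A"
  shows "contains A Q"
proof -
  let ?m = "length ks"
  define g where "g x = (if x < c then e ?m x else if x = c then C else e ?m (x - 1))" for x
  have d: "dims (delete_slice c Q) = ks @ [j]" using Q by simp
  have mono: "strict_mono_on {..<j} (e ?m)" and bound: "e ?m ` {..<j} \<subseteq> {..<n}"
    using embedsD[OF e, of ?m] A(1,3) d by (simp_all del: replicate_Suc)
  have sm: "e ?m x < e ?m y" if "x < y" "y < j" for x y
    using mono that by (auto simp: strict_mono_on_def)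
  have b: "e ?m x < n" if "x < j" for x using bound that by auto
  show ?thesis
  proof (rule contains_change_last[OF Q A(1,3) e d])
    show "strict_mono_on {..<Suc j} g"
      unfolding strict_mono_on_def
    proof (intro allI impI, elim conjE)
      fix x y assume xy: "x \<in> {..<Suc j}" "y \<in> {..<Suc j}" "x < y"
      have "e ?m x < C" if "x < c"
      proof (cases "x < c - 1")
        case True
        moreover have "c - 1 < j" "0 < c" using c that by linarith+
        ultimately show ?thesis using lo sm[of x "c - 1"] by (meson less_trans)
      next
        case False
        then have "x = c - 1" using that by simp
        then show ?thesis using lo that by simp
      qed
      moreover have "C < e ?m (y - 1)" if "c < y"
      proof (cases "c < y - 1")
        case True
        moreover have "y - 1 < j" "c < j" using that xy by auto
        ultimately show ?thesis using hi sm[of c "y - 1"] by (meson less_trans)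
      next
        case False
        then have "y - 1 = c" "c < j" using that xy by auto
        then show ?thesis using hi by simp
      qed
      ultimately show "g x < g y"
        using sm[of x y] sm[of x "y - 1"] sm[of "x - 1" "y - 1"] xy c
        by (cases x c rule: linorder_cases; cases y c rule: linorder_cases) (auto simp: g_def)
    qed
    show "g ` {..<Suc j} \<subseteq> {..<n}"
    proof (rule image_subsetI, unfold lessThan_iff)
      fix x assume "x < Suc j"
      then have "e ?m x < n" if "x < c" using b c that by simp
      moreover have "e ?m (x - 1) < n" if "c < x" using b \<open>x < Suc j\<close> that by simp
      ultimately show "g x < n" using C by (simp add: g_def)
    qed
    fix r y assume x: "r @ [y] \<in> ones Q"
    then have r: "length r = ?m" using Q(2) length_positions by fastforce
    have old: "map2 e [0..<length r] r @ [e ?m z] \<in> ones A"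
      if "r @ [z] \<in> ones (delete_slice c Q)" for z
    proof -
      have "map2 e [0..<length (r @ [z])] (r @ [z]) \<in> ones A"
        using e A(2) that unfolding embeds_def by blast
      then show ?thesis unfolding map2_upt_snoc r .
    qed
    show "map2 e [0..<length r] r @ [g y] \<in> ones A"
    proof (cases y c rule: linorder_cases)
      case greater
      then obtain y' where "y = Suc y'" "c \<le> y'" by (cases y) auto
      then show ?thesis using old[of y'] x by (simp add: g_def)
    qed (use old[of y] new[of r] x in \<open>auto simp: g_def\<close>)
  qed
qed

text \<open>The contrapositive of the transfer: if every \<open>Q\<close>-free host could be thinned
  to avoid the smaller pattern, its bound \<open>O(n^m)\<close> would pass to \<open>Q\<close>. So
  for each \<open>K\<close> there is a \<open>Q\<close>-free host in which every dense enough part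
  contains the smaller pattern.\<close>

lemma minimally_non_O_delete_slice:
  assumes min: "minimally_non_O (Suc m) Q" and dims: "dims Q = ks @ [Suc j]"
    and c: "c \<le> j" "0 < j"
  shows "\<exists>n A. is_matrix (Suc m) A \<and> dims A = replicate (Suc m) n \<and> \<not> contains A Q \<and>
    (\<forall>A'. dims A' = dims A \<and> ones A' \<subseteq> ones A \<and>
       card (ones A) \<le> K * card (ones A') + K * n ^ m \<longrightarrow>
       (\<exists>e. embeds e A' (delete_slice c Q)))"
proof -
  let ?Q' = "delete_slice c Q"
  have Q: "is_matrix (Suc m) Q" using min by (simp add: minimally_non_O_def)
  then have ones: "ones Q \<subseteq> positions (ks @ [Suc j])" using dims by (simp add: is_matrix_snoc)
  have Q': "is_matrix (Suc m) ?Q'" using Q dims c by (rule is_matrix_delete_slice)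
  have m: "length ks = m" using Q dims by (simp add: is_matrix_snoc)
  have "contains Q ?Q'"
    using Q' embeds_delete_slice[OF dims ones c(1)] contains_iff_embeds[of Q ?Q'] dims
    by (auto simp: is_matrix_def)
  moreover have "?Q' \<noteq> Q" using dims by (metis dims_delete_slice last_snoc n_not_Suc_n)
  ultimately have O: "(\<lambda>n. real (ex_num n ?Q' (Suc m))) \<in> O(\<lambda>n. real n ^ (Suc m - 1))"
    using min Q' unfolding minimally_non_O_def by blast
  show ?thesis
  proof (rule ccontr)
    assume no: "\<not> ?thesis"
    have "(\<lambda>n. real (ex_num n Q (Suc m))) \<in> O(\<lambda>n. real n ^ (Suc m - 1))"
    proof (rule bigo_ex_num_transfer[OF _ O])
      fix n A assume A: "is_matrix (Suc m) A" "dims A = replicate (Suc m) n" "\<not> contains A Q"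
      obtain A' where A': "dims A' = dims A" "ones A' \<subseteq> ones A"
        "card (ones A) \<le> K * card (ones A') + K * n ^ m" "\<not> (\<exists>e. embeds e A' ?Q')"
        using no A by blast
      have "is_matrix (Suc m) A'" using A A' by (auto simp: is_matrix_def)
      moreover have "\<not> contains A' ?Q'"
        using contains_iff_embeds[of A' ?Q'] A' Q' A by (auto simp: is_matrix_def)
      ultimately show "\<exists>A'. is_matrix (Suc m) A' \<and> dims A' = replicate (Suc m) n \<and>
          \<not> contains A' ?Q' \<and> card (ones A) \<le> K * card (ones A') + K * n ^ (Suc m - 1)"
        using A A' by auto
    qed
    then show False using minimally_non_O_not_bigo[OF min] by blast
  qed
qed

lemma card_le_mult_card_fibre:
  fixes h :: "'a \<Rightarrow> nat"
  assumes fin: "finite X" and h: "\<And>x. x \<in> X \<Longrightarrow> h x < K"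
  shows "\<exists>p. card X \<le> K * card {x \<in> X. h x = p}"
proof (cases "X = {}")
  case False
  define M where "M = Max ((\<lambda>p. card {x \<in> X. h x = p}) ` {..<K})"
  have K: "{..<K} \<noteq> {}" using h False by fastforce
  have "X = (\<Union>p<K. {x \<in> X. h x = p})" using h by auto
  then have "card X \<le> (\<Sum>p<K. card {x \<in> X. h x = p})"
    by (metis card_UN_le finite_lessThan)
  also have "\<dots> \<le> (\<Sum>p<K. M)" by (intro sum_mono) (simp add: M_def)
  finally have "card X \<le> K * M" by simp
  moreover have "M \<in> (\<lambda>p. card {x \<in> X. h x = p}) ` {..<K}"
    unfolding M_def using K by (intro Max_in) auto
  ultimately show ?thesis by auto
qed simp

text \<open>There are \<open>n ^ m\<close> lines in the last direction, and \<open>X\<close> meets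
  each at most once. Sets of this kind are what thinning may discard.\<close>

lemma card_transversal_le:
  assumes "X \<subseteq> positions (replicate (Suc m) n)" "inj_on butlast X"
  shows "card X \<le> n ^ m"
proof -
  have "butlast x \<in> positions (replicate m n)" if "x \<in> X" for x
  proof -
    have "x \<in> positions (replicate m n @ [n])"
      using assms(1) that by (auto simp: replicate_append_same)
    then show ?thesis by (auto simp: positions_snoc)
  qed
  then have "butlast ` X \<subseteq> positions (replicate m n)" by blast
  then show ?thesis
    using card_inj_on_le[OF assms(2) _ finite_positions] card_positions_replicate by metis
qed

text \<open>Prescribed values are at least \<open>J\<close> apart and at least \<open>J\<close> away
  from the ends of the range, and there are only \<open>J\<close> indices, so all the others fit in
  between.\<close>

lemma strict_mono_on_extension:
  fixes h :: "nat \<Rightarrow> nat"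
  assumes lo: "\<And>z. z \<in> N \<Longrightarrow> J \<le> h z" and hi: "\<And>z. z \<in> N \<Longrightarrow> h z + J \<le> n"
    and gap: "\<And>z z'. z \<in> N \<Longrightarrow> z' \<in> N \<Longrightarrow> z < z' \<Longrightarrow> h z + J \<le> h z'"
    and N: "N \<subseteq> {..<J}" "N \<noteq> {}"
  obtains g where "strict_mono_on {..<J} g" "g ` {..<J} \<subseteq> {..<n}" "\<And>z. z \<in> N \<Longrightarrow> g z = h z"
proof
  \<comment> \<open>Each prescribed index \<open>z\<close> pushes the later ones up with slope one;
    the element \<open>y\<close> itself serves the indices before all of \<open>N\<close>.\<close>
  define T where "T y = insert y ((\<lambda>z. h z + (y - z)) ` {z \<in> N. z \<le> y})" for y
  define g where "g y = Max (T y)" for y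
  have T: "finite (T y)" "T y \<noteq> {}" for y by (auto simp: T_def)
  have gT: "g y \<in> T y" for y using T by (simp add: g_def)
  have "g y < g y'" if "y < y'" for y y'
  proof -
    have "g y + (y' - y) \<in> T y'" using gT[of y] that by (force simp: T_def)
    then have "g y + (y' - y) \<le> g y'" using T by (simp add: g_def)
    then show ?thesis using that by simp
  qed
  then show "strict_mono_on {..<J} g" by (simp add: strict_mono_on_def)
  obtain z0 where "z0 \<in> N" using N by auto
  then have "J \<le> n" using hi[of z0] by simp
  show "g ` {..<J} \<subseteq> {..<n}"
  proof (clarify, simp)
    fix y assume "y < J"
    then have "t < n" if "t \<in> T y" for t using that \<open>J \<le> n\<close> hi N(1)
      by (auto simp: T_def dest!: hi)
    then show "g y < n" using gT by blast
  qed
  show "g z = h z" if z: "z \<in> N" for z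
    unfolding g_def
  proof (rule Max_eqI[OF T(1)])
    show "h z \<in> T z" using z by (force simp: T_def)
    fix t assume "t \<in> T z"
    then consider "t = z" | z' where "z' \<in> N" "z' \<le> z" "t = h z' + (z - z')" by (auto simp: T_def)
    then show "t \<le> h z"
    proof cases
      case 1
      then show ?thesis using lo[OF z] N(1) z by fastforce
    next
      case 2
      then show ?thesis using gap[of z' z] z N(1) by (cases "z' = z") fastforce+
    qed
  qed
qed

text \<open>Only the ones on slices of the host lying in a fixed residue class modulo the number of
  slices of the pattern are kept. This leaves room to place all the empty slices of a copy, not
  just the deleted one.\<close>

lemma minimally_non_O_slice_nonempty:
  assumes min: "minimally_non_O (Suc m) Q" and dims: "dims Q = ks @ [j]" and c: "c < j"
  shows "\<exists>r. r @ [c] \<in> ones Q"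
proof (rule ccontr)
  assume empty: "\<not> ?thesis"
  have Q: "is_matrix (Suc m) Q" using min by (simp add: minimally_non_O_def)
  then have ones: "ones Q \<subseteq> positions (ks @ [j])" and m: "length ks = m"
    using dims by (simp_all add: is_matrix_snoc)
  show False
  proof (cases "ones Q = {}")
    \<comment> \<open>A pattern without ones is contained in every host that is large enough, so its
      extremal function is eventually zero.\<close>
    case True
    have "ex_num n Q (Suc m) = 0" if n: "\<forall>k\<in>set (dims Q). k \<le> n" for n
    proof (rule ccontr)
      assume "ex_num n Q (Suc m) \<noteq> 0"
      then obtain A where A: "dims A = replicate (Suc m) n" "\<not> contains A Q"
        using ex_num_attained by metis
      have "embeds (\<lambda>_ x. x) A Q"
        using A n True Q unfolding embeds_def
        by (auto simp: strict_mono_on_def is_matrix_def simp del: replicate_Suc intro: less_le_trans)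
      then show False using A contains_iff_embeds[of A Q] Q by (auto simp: is_matrix_def)
    qed
    moreover have "\<forall>\<^sub>F n in sequentially. \<forall>k\<in>set (dims Q). k \<le> n"
      by (simp add: eventually_ball_finite eventually_ge_at_top)
    ultimately have "\<forall>\<^sub>F n in sequentially. real (ex_num n Q (Suc m)) = 0"
      by (auto elim: eventually_mono)
    then have "(\<lambda>n. real (ex_num n Q (Suc m))) \<in> O(\<lambda>n. real n ^ (Suc m - 1))"
      using landau_o.big.in_cong[of "\<lambda>n. real (ex_num n Q (Suc m))" "\<lambda>_. 0"] by simp
    then show False using minimally_non_O_not_bigo[OF min] by blast
  next
    case False
    define N where "N = {y. \<exists>r. r @ [y] \<in> ones Q}"
    obtain x where "x \<in> ones Q" using False by blast
    then obtain r y where "r @ [y] \<in> ones Q" using ones positions_snocE by blast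
    then have N: "N \<subseteq> {..<j}" "N \<noteq> {}" "c \<notin> N"
      using empty snoc_in_positionsD(2)[OF ones] by (auto simp: N_def)
    define j' where "j' = j - 1"
    have "j \<noteq> 1"
    proof
      assume "j = 1"
      then have "N \<subseteq> {0}" "c = 0" using N(1) c by auto
      then show False using N by auto
    qed
    then have j': "j = Suc j'" "0 < j'" "c \<le> j'"
      using c by (auto simp: j'_def)
    \<comment> \<open>The constant \<open>2 * j\<close> covers both losses: the factor
      \<open>j\<close> from choosing a residue class, and the \<open>2 * j\<close> outermost slices
      with at most \<open>n ^ m\<close> ones each.\<close>
    obtain n A where A: "is_matrix (Suc m) A" "dims A = replicate (Suc m) n" "\<not> contains A Q"
      and emb: "\<And>A'. dims A' = dims A \<Longrightarrow> ones A' \<subseteq> ones A \<Longrightarrow>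
        card (ones A) \<le> 2 * j * card (ones A') + 2 * j * n ^ m \<Longrightarrow>
        \<exists>e. embeds e A' (delete_slice c Q)"
      using minimally_non_O_delete_slice[OF min _ j'(3,2), of ks "2 * j"] dims j'(1) by blast
    \<comment> \<open>Dropping the outermost \<open>j\<close> slices on both sides leaves room for
      empty slices of the pattern before its first and after its last nonempty slice.\<close>
    define B where "B = {x \<in> ones A. j \<le> last x \<and> last x + j \<le> n}"
    have onesA: "ones A \<subseteq> positions (replicate (Suc m) n)"
      using A by (simp add: is_matrix_def)
    then have fin: "finite (ones A)" using finite_subset finite_positions by blast
    have ne: "x \<noteq> []" if "x \<in> ones A" for x using onesA that by (auto simp: positions_def)
    have bound: "card {x \<in> ones A. last x = y} \<le> n ^ m" for y
    proof (rule card_transversal_le)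
      show "inj_on butlast {x \<in> ones A. last x = y}"
      proof (rule inj_onI)
        fix x x' assume "x \<in> {x \<in> ones A. last x = y}" "x' \<in> {x \<in> ones A. last x = y}"
          and "butlast x = butlast x'"
        then show "x = x'" using ne append_butlast_last_id[of x] append_butlast_last_id[of x'] by simp
      qed
    qed (use onesA in auto)
    define Y where "Y = {..<j} \<union> {n - j..<n}"
    have "card (\<Union>y\<in>Y. {x \<in> ones A. last x = y}) \<le> (\<Sum>y\<in>Y. card {x \<in> ones A. last x = y})"
      by (rule card_UN_le) (simp add: Y_def)
    also have "\<dots> \<le> (\<Sum>y\<in>Y. n ^ m)" by (rule sum_mono[OF bound])
    also have "\<dots> \<le> 2 * j * n ^ m"
    proof -
      have "card Y \<le> card {..<j} + card {n - j..<n}" unfolding Y_def by (rule card_Un_le)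
      then have "card Y \<le> 2 * j" by simp
      then show ?thesis by simp
    qed
    finally have Y: "card (\<Union>y\<in>Y. {x \<in> ones A. last x = y}) \<le> 2 * j * n ^ m" .
    have "ones A \<subseteq> B \<union> (\<Union>y\<in>Y. {x \<in> ones A. last x = y})"
    proof
      fix x assume x: "x \<in> ones A"
      then have "x \<in> positions (replicate m n @ [n])"
        using onesA by (auto simp: replicate_append_same)
      then have "last x < n" by (auto elim: positions_snocE)
      then show "x \<in> B \<union> (\<Union>y\<in>Y. {x \<in> ones A. last x = y})"
        using x by (auto simp: B_def Y_def)
    qed
    moreover have "finite (B \<union> (\<Union>y\<in>Y. {x \<in> ones A. last x = y}))"
      using fin by (simp add: B_def Y_def)
    ultimately have "card (ones A) \<le> card (B \<union> (\<Union>y\<in>Y. {x \<in> ones A. last x = y}))"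
      by (rule card_mono[rotated])
    also have "\<dots> \<le> card B + card (\<Union>y\<in>Y. {x \<in> ones A. last x = y})"
      by (rule card_Un_le)
    finally have le: "card (ones A) \<le> card B + 2 * j * n ^ m" using Y by simp
    obtain p where p: "card B \<le> j * card {x \<in> B. last x mod j = p}"
      using card_le_mult_card_fibre[of B "\<lambda>x. last x mod j" j] fin c by (auto simp: B_def)
    define A' where "A' = Zo_Matrix (dims A) {x \<in> B. last x mod j = p}"
    obtain e where e: "embeds e A' (delete_slice c Q)"
    proof -
      have "card (ones A) \<le> 2 * j * card (ones A') + 2 * j * n ^ m"
        using le p by (simp add: A'_def)
      moreover have "ones A' \<subseteq> ones A" "dims A' = dims A" by (auto simp: A'_def B_def)
      ultimately show ?thesis using emb[of A'] that by blast
    qed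
    have onesA': "x \<in> ones A \<and> j \<le> last x \<and> last x + j \<le> n \<and> last x mod j = p"
      if "x \<in> ones A'" for x
      using that by (auto simp: A'_def B_def)
    define h where "h y = e m (if y < c then y else y - 1)" for y
    have img: "map2 e [0..<length r] r @ [h y] \<in> ones A'" if "r @ [y] \<in> ones Q" for r y
    proof -
      have "length r = m" using snoc_in_positionsD(3)[OF ones that] m by simp
      moreover have "y \<noteq> c" using empty that by auto
      then have "r @ [if y < c then y else y - 1] \<in> ones (delete_slice c Q)"
        using that by auto
      then have "map2 e [0..<length (r @ [if y < c then y else y - 1])]
          (r @ [if y < c then y else y - 1]) \<in> ones A'"
        using e unfolding embeds_def by blast
      ultimately show ?thesis unfolding map2_upt_snoc h_def by simp
    qed
    have h: "j \<le> h y \<and> h y + j \<le> n \<and> h y mod j = p" if y: "y \<in> N" for y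
    proof -
      obtain r where "r @ [y] \<in> ones Q" using y by (auto simp: N_def)
      from onesA'[OF img[OF this]] show ?thesis by simp
    qed
    have d: "dims (delete_slice c Q) = ks @ [j']" using dims j' by simp
    have smono: "strict_mono_on {..<j'} (e m)"
      using embedsD(1)[OF e, of m] d m by (simp add: nth_append)
    \<comment> \<open>Equal residues modulo \<open>j\<close> turn strict growth into steps of at
      least \<open>j\<close>.\<close>
    have gap: "h z + j \<le> h z'" if z: "z \<in> N" "z' \<in> N" "z < z'" for z z'
    proof -
      have "z \<noteq> c" "z' \<noteq> c" "z' < j" using N z by auto
      then have "h z < h z'"
        using z(3) j' unfolding h_def by (intro strict_mono_onD[OF smono]) auto
      moreover have "j dvd h z' - h z"
        using h[OF z(1)] h[OF z(2)] calculation by (metis mod_eq_dvd_iff_nat less_imp_le)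
      ultimately show ?thesis by (auto dest!: dvd_imp_le)
    qed
    obtain g where g: "strict_mono_on {..<j} g" "g ` {..<j} \<subseteq> {..<n}"
      "\<And>z. z \<in> N \<Longrightarrow> g z = h z"
    proof (rule strict_mono_on_extension[of N j h n])
      show "j \<le> h z" "h z + j \<le> n" if "z \<in> N" for z using h[OF that] by auto
    qed (use gap N in auto)
    have "contains A Q"
    proof (rule contains_change_last[OF dims ones _ _ e d g(1,2)])
      fix r y assume y: "r @ [y] \<in> ones Q"
      then have "g y = h y" by (intro g) (auto simp: N_def)
      then show "map2 e [0..<length r] r @ [g y] \<in> ones A"
        using img[OF y] onesA' by auto
    qed (use A m in \<open>auto simp: A'_def\<close>)
    then show False using A by blast
  qed
qed

definition line_rank :: "nat list set \<Rightarrow> nat list \<Rightarrow> nat" where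
  "line_rank X x = card {y. y < last x \<and> butlast x @ [y] \<in> X}"

lemma line_rank_next:
  assumes "y1 < y2" "\<And>y. y1 < y \<Longrightarrow> y < y2 \<Longrightarrow> R @ [y] \<notin> X" "R @ [y1] \<in> X"
  shows "line_rank X (R @ [y2]) = Suc (line_rank X (R @ [y1]))"
proof -
  have "{y. y < y2 \<and> R @ [y] \<in> X} = insert y1 {y. y < y1 \<and> R @ [y] \<in> X}"
    using assms by (force simp: not_less_iff_gr_or_eq)
  then show ?thesis by (simp add: line_rank_def)
qed

lemma mod2_Suc_neq: "Suc a mod 2 \<noteq> a mod 2"
  by presburger

text \<open>In the host every second one of each line in the last direction is discarded, together with
  the first one, so that the line through two consecutive kept ones has a spare one between them.\<close>

lemma minimally_non_O_not_lonely:
  assumes min: "minimally_non_O (Suc m) Q" and dims: "dims Q = ks @ [j]"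
    and up: "r @ [Suc c] \<in> ones Q" and down: "c = 0 \<or> r @ [c - 1] \<in> ones Q"
  shows "\<exists>r'. r' \<noteq> r \<and> r' @ [c] \<in> ones Q"
proof (rule ccontr)
  assume lonely: "\<not> ?thesis"
  have Q: "is_matrix (Suc m) Q" using min by (simp add: minimally_non_O_def)
  then have ones: "ones Q \<subseteq> positions (ks @ [j])" and m: "length ks = m"
    using dims by (simp_all add: is_matrix_snoc)
  have r: "length r = m" and "Suc c < j" using snoc_in_positionsD[OF ones up] m by auto
  define j' where "j' = j - 1"
  have j': "j = Suc j'" "0 < j'" "c < j'" "c \<le> j'" using \<open>Suc c < j\<close> by (auto simp: j'_def)
  \<comment> \<open>The factor 2 pays for the choice of a parity of ranks, the additive term for the
    first ones of the lines.\<close>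
  obtain n A where A: "is_matrix (Suc m) A" "dims A = replicate (Suc m) n" "\<not> contains A Q"
    and emb: "\<And>A'. dims A' = dims A \<Longrightarrow> ones A' \<subseteq> ones A \<Longrightarrow>
      card (ones A) \<le> 2 * card (ones A') + 2 * n ^ m \<Longrightarrow>
      \<exists>e. embeds e A' (delete_slice c Q)"
    using minimally_non_O_delete_slice[OF min _ j'(4,2), of ks 2] dims j'(1) by blast
  let ?rk = "line_rank (ones A)"
  have onesA: "ones A \<subseteq> positions (replicate m n @ [n])"
    using A by (simp add: is_matrix_def replicate_append_same)
  then have fin: "finite (ones A)" using finite_subset finite_positions by blast
  define B where "B = {x \<in> ones A. 0 < ?rk x}"
  have "card (ones A - B) \<le> n ^ m"
  proof (rule card_transversal_le)
    show "ones A - B \<subseteq> positions (replicate (Suc m) n)"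
      using onesA by (auto simp: replicate_append_same)
    show "inj_on butlast (ones A - B)"
    proof (rule inj_onI)
      fix x x' assume x: "x \<in> ones A - B" "x' \<in> ones A - B" "butlast x = butlast x'"
      obtain R y y' where xy: "x = R @ [y]" "x' = R @ [y']"
        using x onesA by (metis DiffD1 butlast_snoc positions_snocE subsetD)
      have none: "\<not> (z < last u \<and> butlast u @ [z] \<in> ones A)" if "u \<in> ones A - B" for u z
      proof -
        have "card {y. y < last u \<and> butlast u @ [y] \<in> ones A} = 0"
          using that by (simp add: B_def line_rank_def)
        then show ?thesis by simp
      qed
      have "\<not> y < y'" "\<not> y' < y" using none[OF x(1), of y'] none[OF x(2), of y] x xy by auto
      then show "x = x'" using xy by simp
    qed
  qed
  moreover have "card (ones A) = card B + card (ones A - B)"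
    using fin by (subst card_Un_disjoint[symmetric]) (auto simp: B_def intro!: arg_cong[of _ _ card])
  ultimately have le: "card (ones A) \<le> card B + n ^ m" by simp
  obtain p where p: "card B \<le> 2 * card {x \<in> B. ?rk x mod 2 = p}"
    using card_le_mult_card_fibre[of B "\<lambda>x. ?rk x mod 2" 2] fin by (auto simp: B_def)
  define A' where "A' = Zo_Matrix (dims A) {x \<in> B. ?rk x mod 2 = p}"
  have sub: "ones A' \<subseteq> ones A" by (auto simp: A'_def B_def)
  obtain e where e: "embeds e A' (delete_slice c Q)"
  proof -
    have "card (ones A) \<le> 2 * card (ones A') + 2 * n ^ m"
      using le p by (simp add: A'_def)
    then show ?thesis using emb[of A'] that sub by (auto simp: A'_def)
  qed
  have d: "dims (delete_slice c Q) = ks @ [j']" using dims j' by simp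
  have smono: "strict_mono_on {..<j'} (e m)" and bound: "e m ` {..<j'} \<subseteq> {..<n}"
    using embedsD[OF e, of m] d m A by (simp_all add: A'_def nth_append del: replicate_Suc)
  define R where "R = map2 e [0..<length r] r"
  have img: "R @ [e m y] \<in> ones A'" if "r @ [y] \<in> ones (delete_slice c Q)" for y
  proof -
    have "map2 e [0..<length (r @ [y])] (r @ [y]) \<in> ones A'"
      using e that unfolding embeds_def by blast
    then show ?thesis unfolding map2_upt_snoc R_def r .
  qed
  have onesA': "0 < ?rk x \<and> ?rk x mod 2 = p" if "x \<in> ones A'" for x
    using that by (auto simp: A'_def B_def)
  \<comment> \<open>Index \<open>c\<close> of the smaller pattern is slice \<open>Suc c\<close> of
    \<open>Q\<close>, which has a one on line \<open>r\<close>.\<close>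
  have hi: "R @ [e m c] \<in> ones A'" using img[of c] up by simp
  have "\<exists>C. C < e m c \<and> R @ [C] \<in> ones A \<and> (0 < c \<longrightarrow> e m (c - 1) < C)"
  proof (cases "c = 0")
    case True
    have "{y. y < e m c \<and> R @ [y] \<in> ones A} \<noteq> {}"
      using onesA'[OF hi] by (auto simp: line_rank_def card_gt_0_iff)
    then show ?thesis using True by auto
  next
    case False
    then have lo: "R @ [e m (c - 1)] \<in> ones A'" using img[of "c - 1"] down by simp
    have "e m (c - 1) < e m c" using False j' by (intro strict_mono_onD[OF smono]) auto
    \<comment> \<open>With no one of the host in between, the two kept ones would have consecutive
      ranks, hence different parities.\<close>
    then have "\<exists>y. e m (c - 1) < y \<and> y < e m c \<and> R @ [y] \<in> ones A"
      using line_rank_next[of "e m (c - 1)" "e m c" R "ones A"] onesA'[OF hi] onesA'[OF lo] lo sub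
      by (metis mod2_Suc_neq subsetD)
    then show ?thesis by auto
  qed
  then obtain C where C: "C < e m c" "R @ [C] \<in> ones A" "0 < c \<Longrightarrow> e m (c - 1) < C" by blast
  \<comment> \<open>Since \<open>r\<close> is the only line with a one in slice \<open>c\<close>,
    the single spare one at \<open>C\<close> fills the whole slice.\<close>
  have "contains A Q"
  proof (rule contains_insert_slice[OF _ _ j'(4) _ sub _ e])
    show "C < n" using C(1) bound j'(3) by fastforce
    show "map2 e [0..<length r'] r' @ [C] \<in> ones A" if "r' @ [c] \<in> ones Q" for r'
      using lonely that C(2) by (auto simp: R_def)
  qed (use dims j' ones A m C in \<open>auto simp: A'_def\<close>)
  then show False using A by blast
qed

section \<open>Superlinear planar matrices\<close>

definition superlinear :: "(nat \<Rightarrow> (nat \<times> nat) set) \<Rightarrow> bool" where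
  "superlinear M \<longleftrightarrow>
     (\<forall>n. M n \<subseteq> {..<n} \<times> {..<n}) \<and> (\<forall>K. \<forall>\<^sub>F n in sequentially. K * n \<le> card (M n))"

definition flip_rows :: "(nat \<Rightarrow> (nat \<times> nat) set) \<Rightarrow> nat \<Rightarrow> (nat \<times> nat) set" where
  "flip_rows M n = {(a, b). a < n \<and> (n - 1 - a, b) \<in> M n}"

definition flip_cols :: "(nat \<Rightarrow> (nat \<times> nat) set) \<Rightarrow> nat \<Rightarrow> (nat \<times> nat) set" where
  "flip_cols M n = {(a, b). b < n \<and> (a, n - 1 - b) \<in> M n}"

lemma superlinear_flip_rows:
  assumes "superlinear M" shows "superlinear (flip_rows M)"
proof -
  have sub: "M n \<subseteq> {..<n} \<times> {..<n}" for n using assms by (simp add: superlinear_def)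
  have "card (flip_rows M n) = card (M n)" for n
    by (rule bij_betw_same_card, rule bij_betw_byWitness[where f = "\<lambda>(a, b). (n - 1 - a, b)" and
          f' = "\<lambda>(a, b). (n - 1 - a, b)"])
      (use sub[of n] in \<open>auto simp: flip_rows_def\<close>)
  then show ?thesis using assms sub by (fastforce simp: superlinear_def flip_rows_def)
qed

lemma superlinear_flip_cols:
  assumes "superlinear M" shows "superlinear (flip_cols M)"
proof -
  have sub: "M n \<subseteq> {..<n} \<times> {..<n}" for n using assms by (simp add: superlinear_def)
  have "card (flip_cols M n) = card (M n)" for n
    by (rule bij_betw_same_card, rule bij_betw_byWitness[where f = "\<lambda>(a, b). (a, n - 1 - b)" and
          f' = "\<lambda>(a, b). (a, n - 1 - b)"])
      (use sub[of n] in \<open>auto simp: flip_cols_def\<close>)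
  then show ?thesis using assms sub by (fastforce simp: superlinear_def flip_cols_def)
qed

text \<open>The other \<open>m - 1\<close> coordinates are free. The map \<open>\<phi>\<close> puts
  \<open>a\<close> at index \<open>i\<close> and \<open>b\<close> at the end of an arbitrary tuple
  \<open>z\<close>.\<close>

lemma card_plane_lift_ge:
  assumes "X \<subseteq> {..<n} \<times> {..<n}" "i < m"
  shows "card X * n ^ (m - 1) \<le>
    card {x \<in> positions (replicate (Suc m) n). (x ! i, x ! m) \<in> X}"
proof -
  let ?Z = "positions (replicate (m - 1) n)"
  define \<phi> where "\<phi> = (\<lambda>((a, b), z). take i z @ [a] @ drop i z @ [b :: nat])"
  have "card (X \<times> ?Z) \<le> card {x \<in> positions (replicate (Suc m) n). (x ! i, x ! m) \<in> X}"
  proof (rule card_inj_on_le)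
    show "inj_on \<phi> (X \<times> ?Z)"
    proof (rule inj_onI)
      fix p q assume pq: "p \<in> X \<times> ?Z" "q \<in> X \<times> ?Z" "\<phi> p = \<phi> q"
      obtain a b z a' b' z' where p: "p = ((a, b), z)" "q = ((a', b'), z')"
        by (metis surj_pair)
      then have z: "z \<in> ?Z" "z' \<in> ?Z" and eq: "\<phi> ((a, b), z) = \<phi> ((a', b'), z')"
        using pq by auto
      have "length (take i z) = length (take i z')" using z by (simp add: positions_def)
      then have "take i z = take i z'" "a = a'" "drop i z = drop i z'" "b = b'"
        using eq by (auto simp: \<phi>_def)
      then show "p = q" unfolding p by (metis append_take_drop_id)
    qed
    show "\<phi> ` (X \<times> ?Z) \<subseteq> {x \<in> positions (replicate (Suc m) n). (x ! i, x ! m) \<in> X}"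
    proof (rule image_subsetI, clarify)
      fix a b z assume ab: "(a, b) \<in> X" and z: "z \<in> ?Z"
      have len: "length (\<phi> ((a, b), z)) = Suc m" "length (take i z) = i"
        using z assms(2) by (auto simp: positions_def \<phi>_def)
      have set: "set (\<phi> ((a, b), z)) \<subseteq> {..<n}"
        using z ab assms(1)
        by (auto simp: positions_def \<phi>_def in_set_conv_nth dest!: in_set_takeD in_set_dropD)
      have "\<phi> ((a, b), z) ! k < n" if "k < Suc m" for k
        using set nth_mem[of k "\<phi> ((a, b), z)"] that len(1) by (metis lessThan_iff subsetD)
      then have "\<phi> ((a, b), z) \<in> positions (replicate (Suc m) n)"
        using len(1) by (simp add: positions_def del: replicate_Suc)
      moreover have "\<phi> ((a, b), z) ! i = a"
        using len(2) by (simp add: \<phi>_def nth_append)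
      moreover have "\<phi> ((a, b), z) ! m = b"
      proof -
        have "\<phi> ((a, b), z) ! m = last (\<phi> ((a, b), z))"
          using len(1) by (metis diff_Suc_1 last_conv_nth length_0_conv nat.distinct(1))
        then show ?thesis by (simp add: \<phi>_def)
      qed
      ultimately show "\<phi> ((a, b), z) \<in> positions (replicate (Suc m) n) \<and>
          (\<phi> ((a, b), z) ! i, \<phi> ((a, b), z) ! m) \<in> X"
        using ab by simp
    qed
  qed simp
  then show ?thesis by (simp add: card_cartesian_product card_positions_replicate)
qed

text \<open>By \<open>avoid\<close>, where \<open>f\<close> and \<open>g\<close> are the axis maps
  \<open>i\<close> and \<open>m\<close> of a supposed copy, the lift of \<open>M n\<close> avoids
  the pattern with ones \<open>F\<close>. That pattern is thus not \<open>O(n^m)\<close>, and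
  minimality forces it to be \<open>Q\<close> itself.\<close>

lemma minimally_non_O_ones_eq:
  assumes min: "minimally_non_O (Suc m) Q" and dims: "dims Q = ks @ [j]" and i: "i < m"
    and M: "superlinear M" and F: "F \<subseteq> ones Q"
    and avoid: "\<And>n f g. strict_mono_on {..<ks ! i} f \<Longrightarrow> strict_mono_on {..<j} g \<Longrightarrow>
      (\<And>r c. r @ [c] \<in> F \<Longrightarrow> (f (r ! i), g c) \<in> M n) \<Longrightarrow> False"
  shows "ones Q = F"
proof (rule ccontr)
  assume "ones Q \<noteq> F"
  have Q: "is_matrix (Suc m) Q" using min by (simp add: minimally_non_O_def)
  then have ones: "ones Q \<subseteq> positions (ks @ [j])" and m: "length ks = m"
    using dims by (simp_all add: is_matrix_snoc)
  define Q' where "Q' = Zo_Matrix (dims Q) F"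
  have Q': "is_matrix (Suc m) Q'" using Q F by (auto simp: Q'_def is_matrix_def)
  have "Q' \<noteq> Q" using \<open>ones Q \<noteq> F\<close> by (metis Q'_def zo_matrix.sel(2))
  have "embeds (\<lambda>_ x. x) Q Q'" using F by (intro embeds_id) (auto simp: Q'_def)
  then have "contains Q Q'"
    using Q' contains_iff_embeds[of Q Q'] by (auto simp: Q'_def is_matrix_def)
  then have "(\<lambda>n. real (ex_num n Q' (Suc m))) \<in> O(\<lambda>n. real n ^ m)"
    using min Q' \<open>Q' \<noteq> Q\<close> by (auto simp: minimally_non_O_def)
  then obtain C where C: "\<forall>\<^sub>F n in sequentially. norm (real (ex_num n Q' (Suc m))) \<le> C * norm (real n ^ m)"
    using landau_o.bigE by blast
  \<comment> \<open>Superlinearity is used for one \<open>K\<close> above the constant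
    \<open>C\<close> of the assumed bound, which gives \<open>K * n ^ m \<le> C * n ^ m\<close> for
    some positive \<open>n\<close>.\<close>
  obtain K :: nat where "C < real K" using reals_Archimedean2 by blast
  have "\<forall>\<^sub>F n in sequentially. K * n \<le> card (M n)"
    using M by (simp add: superlinear_def)
  with C have "\<forall>\<^sub>F n in sequentially. real (ex_num n Q' (Suc m)) \<le> C * real n ^ m \<and>
      K * n \<le> card (M n) \<and> 0 < n"
    using eventually_gt_at_top[of "0 :: nat"] by eventually_elim simp
  then obtain n where n: "real (ex_num n Q' (Suc m)) \<le> C * real n ^ m" "K * n \<le> card (M n)" "0 < n"
    using eventually_happens'[OF sequentially_bot] by blast
  define A where "A = Zo_Matrix (replicate (Suc m) n)
    {x \<in> positions (replicate (Suc m) n). (x ! i, x ! m) \<in> M n}"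
  have A: "is_matrix (Suc m) A" using n(3) by (auto simp: A_def is_matrix_def)
  have "\<not> contains A Q'"
  proof
    assume "contains A Q'"
    then obtain e where e: "embeds e A Q'"
      using contains_iff_embeds[of A Q'] Q' A by (auto simp: is_matrix_def)
    show False
    proof (rule avoid)
      show "strict_mono_on {..<ks ! i} (e i)" "strict_mono_on {..<j} (e m)"
        using embedsD(1)[OF e, of i] embedsD(1)[OF e, of m] i dims m
        by (auto simp: Q'_def nth_append)
      fix r c assume rc: "r @ [c] \<in> F"
      then have r: "length r = m" using F ones m snoc_in_positionsD(3) by blast
      have "map2 e [0..<length (r @ [c])] (r @ [c]) \<in> ones A"
        using e rc unfolding embeds_def by (auto simp: Q'_def)
      then show "(e i (r ! i), e m c) \<in> M n"
        unfolding map2_upt_snoc using i by (simp add: A_def r nth_append)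
    qed
  qed
  then have "card (ones A) \<le> ex_num n Q' (Suc m)"
    using A by (intro ex_num_ge) (auto simp: A_def)
  moreover have "card (M n) * n ^ (m - 1) \<le> card (ones A)"
    using card_plane_lift_ge[OF _ i] M by (simp add: A_def superlinear_def del: replicate_Suc)
  moreover have "K * n ^ m \<le> card (M n) * n ^ (m - 1)"
    using mult_le_mono1[OF n(2), of "n ^ (m - 1)"] i by (cases m) (simp_all add: mult_ac)
  ultimately have "K * n ^ m \<le> ex_num n Q' (Suc m)" by linarith
  then have "real K * real n ^ m \<le> real (ex_num n Q' (Suc m))"
    by (metis of_nat_le_iff of_nat_mult of_nat_power)
  then have "real K * real n ^ m \<le> C * real n ^ m" using n(1) by linarith
  then show False using \<open>C < real K\<close> n(3) by simp
qed

section \<open>Two rows meeting in an outermost column\<close>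

definition dyadic :: "nat \<Rightarrow> (nat \<times> nat) set" where
  "dyadic n = {(a, b). a < n \<and> b < n \<and> (\<exists>k. b = a + 2 ^ k)}"

text \<open>Once \<open>2 ^ (2 * K + 1) \<le> n\<close>, each of the first
  \<open>n - n div 2\<close> rows has a one at distance \<open>2 ^ k\<close> for all
  \<open>k < 2 * K\<close>.\<close>

lemma superlinear_dyadic: "superlinear dyadic"
  unfolding superlinear_def
proof (intro conjI allI)
  fix n show "dyadic n \<subseteq> {..<n} \<times> {..<n}" by (auto simp: dyadic_def)
next
  fix K :: nat
  have "K * n \<le> card (dyadic n)" if n: "2 ^ (2 * K + 1) \<le> n" for n
  proof -
    let ?I = "{..<2 * K} \<times> {..<n - n div 2}"
    have "2 ^ k \<le> n div 2" if "k < 2 * K" for k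
    proof -
      have "(2 :: nat) ^ Suc k \<le> 2 ^ (2 * K + 1)" using that by (intro power_increasing) auto
      then have "2 * 2 ^ k \<le> n" using n unfolding power_Suc by (rule order_trans)
      then show ?thesis by linarith
    qed
    then have "(\<lambda>(k, a). (a, a + 2 ^ k)) ` ?I \<subseteq> dyadic n"
      by (fastforce simp: dyadic_def)
    moreover have "inj_on (\<lambda>(k, a). (a, a + 2 ^ k :: nat)) ?I" by (auto simp: inj_on_def)
    moreover have "finite (dyadic n)"
      by (rule finite_subset[of _ "{..<n} \<times> {..<n}"]) (auto simp: dyadic_def)
    ultimately have "card ?I \<le> card (dyadic n)"
      using card_inj_on_le[of "\<lambda>(k, a). (a, a + 2 ^ k)" ?I "dyadic n"] by blast
    moreover have "K * n \<le> card ?I"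
    proof -
      have "n \<le> 2 * (n - n div 2)" by linarith
      then have "K * n \<le> K * (2 * (n - n div 2))" by (rule mult_le_mono2)
      then show ?thesis by (simp add: card_cartesian_product mult_ac)
    qed
    ultimately show ?thesis by linarith
  qed
  then show "\<forall>\<^sub>F n in sequentially. K * n \<le> card (dyadic n)"
    unfolding eventually_sequentially by blast
qed

text \<open>A one at distance \<open>2 ^ k\<close> from the diagonal lies at least \<open>2 ^ (k - 1)\<close> columns beyond
  every earlier one of its row, and at most \<open>2 ^ k - 1\<close>.\<close>

lemma dyadic_avoids:
  assumes D: "(r1, c1) \<in> dyadic n" "(r2, c2) \<in> dyadic n" "(r1, c) \<in> dyadic n" "(r2, c) \<in> dyadic n"
    and lt: "r1 < r2" "c1 < c" "c2 < c"
  shows "c1 < c2"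
proof -
  obtain e1 e2 k1 k2 where e: "c1 = r1 + 2 ^ e1" "c2 = r2 + 2 ^ e2" "c = r1 + 2 ^ k1" "c = r2 + 2 ^ k2"
    using D by (auto simp: dyadic_def)
  have "(2 :: nat) ^ e1 < 2 ^ k1" using e lt by linarith
  then have "e1 < k1" by simp
  moreover have "(2 :: nat) ^ k2 < 2 ^ k1" using e lt by linarith
  then have "k2 < k1" by simp
  ultimately have "(2 :: nat) ^ e1 \<le> 2 ^ (k1 - 1)" "(2 :: nat) ^ k2 \<le> 2 ^ (k1 - 1)"
    by (auto intro!: power_increasing)
  moreover have "(2 :: nat) ^ k1 = 2 * 2 ^ (k1 - 1)"
    using \<open>e1 < k1\<close> by (metis Suc_diff_1 less_nat_zero_code neq0_conv power_Suc)
  moreover have "(0 :: nat) < 2 ^ e2" by simp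
  \<comment> \<open>The point \<open>r1 + 2 ^ (k1 - 1)\<close> halfway between \<open>r1\<close> and
    \<open>c\<close> separates: \<open>c1\<close> is at most this point, \<open>r2\<close> is at
    least this point, and \<open>c2\<close> exceeds \<open>r2\<close>.\<close>
  ultimately show ?thesis using e by linarith
qed

text \<open>The dyadic set excludes \<open>c2 \<le> c1 < c\<close> for a smaller row
  \<open>r1\<close>, including the full 2 by 2 square. The other configurations are its reflections
  in the rows, in the columns or in both.\<close>

lemma minimally_non_O_two_rows:
  assumes min: "minimally_non_O (Suc m) Q" and dims: "dims Q = ks @ [j]" and i: "i < m"
    and ones: "r1 @ [c1] \<in> ones Q" "r2 @ [c2] \<in> ones Q" "r1 @ [c] \<in> ones Q" "r2 @ [c] \<in> ones Q"
    and ne: "r1 ! i \<noteq> r2 ! i"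
    and c: "c1 < c \<and> c2 < c \<or> c < c1 \<and> c < c2"
  shows "ones Q = {r1 @ [c1], r2 @ [c2], r1 @ [c], r2 @ [c]}"
  using ones ne c
proof (induction "r1 ! i" "r2 ! i" arbitrary: r1 r2 c1 c2 rule: linorder_wlog)
  case sym
  show ?case using sym(1)[of r2 r1 c2 c1] sym(2-) by auto
next
  case le
  let ?F = "{r1 @ [c1], r2 @ [c2], r1 @ [c], r2 @ [c]}"
  let ?r1 = "r1 ! i" and ?r2 = "r2 ! i"
  define M where "M =
    (if c1 < c then if c2 \<le> c1 then dyadic else flip_rows dyadic
     else if c1 \<le> c2 then flip_cols dyadic else flip_rows (flip_cols dyadic))"
  have Q: "is_matrix (Suc m) Q" using min by (simp add: minimally_non_O_def)
  then have pos: "ones Q \<subseteq> positions (ks @ [j])" and m: "length ks = m"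
    using dims by (simp_all add: is_matrix_snoc)
  have b: "?r1 < ks ! i" "?r2 < ks ! i" "c1 < j" "c2 < j" "c < j"
    using snoc_in_positionsD(1,2)[OF pos] le(2-5) i m by (auto simp: positions_def)
  show ?case
  proof (rule minimally_non_O_ones_eq[OF min dims i, of M])
    show "superlinear M"
      by (simp add: M_def superlinear_dyadic superlinear_flip_rows superlinear_flip_cols)
    show "?F \<subseteq> ones Q" using le by auto
    fix n f g
    assume f: "strict_mono_on {..<ks ! i} f" and g: "strict_mono_on {..<j} g"
      and img: "\<And>r c. r @ [c] \<in> ?F \<Longrightarrow> (f (r ! i), g c) \<in> M n"
    have fr: "f ?r1 < f ?r2" using strict_mono_onD[OF f] b le(1,6) by auto
    have gm: "g x < g y" if "x < y" "y < j" for x y using strict_mono_onD[OF g] that by auto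
    have gm': "g x \<le> g y" if "x \<le> y" "y < j" for x y
      using gm[of x y] that by (cases "x = y") auto
    have "M n \<subseteq> {..<n} \<times> {..<n}" using \<open>superlinear M\<close> by (simp add: superlinear_def)
    moreover have img': "(f ?r1, g c1) \<in> M n" "(f ?r2, g c2) \<in> M n" "(f ?r1, g c) \<in> M n" "(f ?r2, g c) \<in> M n"
      using img by auto
    ultimately have n: "f ?r1 < n" "f ?r2 < n" "g c1 < n" "g c2 < n" "g c < n" by auto
    show False
    proof (cases "c1 < c")
      case True
      then have lt: "g c1 < g c" "g c2 < g c" using le(7) gm b by auto
      show False
      proof (cases "c2 \<le> c1")
        case le: True
        then have "M = dyadic" using True by (simp add: M_def)
        then have "g c1 < g c2" using dyadic_avoids[OF _ _ _ _ fr lt] img' by auto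
        then show False using gm'[OF le b(3)] by simp
      next
        case False
        then have "M = flip_rows dyadic" using True by (simp add: M_def)
        then have "g c2 < g c1"
          using dyadic_avoids[of "n - 1 - f ?r2" "g c2" n "n - 1 - f ?r1" "g c1" "g c"] img' fr lt n
          by (auto simp: flip_rows_def)
        then show False using gm[of c1 c2] False b by simp
      qed
    next
      case False
      then have lt: "n - 1 - g c1 < n - 1 - g c" "n - 1 - g c2 < n - 1 - g c"
        using le(7) gm[of c c1] gm[of c c2] b n by auto
      show False
      proof (cases "c1 \<le> c2")
        case le: True
        then have "M = flip_cols dyadic" using False by (simp add: M_def)
        then have "n - 1 - g c1 < n - 1 - g c2"
          using dyadic_avoids[OF _ _ _ _ fr lt] img' by (auto simp: flip_cols_def)
        then show False using gm'[OF le b(4)] by simp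
      next
        case nle: False
        then have "M = flip_rows (flip_cols dyadic)" using False by (simp add: M_def)
        then have "n - 1 - g c2 < n - 1 - g c1"
          using dyadic_avoids[OF _ _ _ _ _ lt(2,1), of "n - 1 - f ?r2" n "n - 1 - f ?r1"] img' fr n
          by (auto simp: flip_rows_def flip_cols_def)
        then show False using gm[of c2 c1] nle b by simp
      qed
    qed
  qed
qed

section \<open>A dense matrix without alternation\<close>

text \<open>Rows of a pattern are embedded monotonically, so it is enough to forbid the alternation
  that starts in the smaller row; \<open>flip_rows\<close> yields the opposite one.\<close>

definition abab_free :: "(nat \<times> nat) set \<Rightarrow> bool" where
  "abab_free X \<longleftrightarrow> (\<forall>a b c1 c2 c3 c4. a < b \<longrightarrow> c1 < c2 \<longrightarrow> c2 < c3 \<longrightarrow> c3 < c4 \<longrightarrow>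
     (a, c1) \<in> X \<longrightarrow> (b, c2) \<in> X \<longrightarrow> (a, c3) \<in> X \<longrightarrow> (b, c4) \<notin> X)"

lemma abab_freeI:
  "(\<And>a b c1 c2 c3 c4. a < b \<Longrightarrow> c1 < c2 \<Longrightarrow> c2 < c3 \<Longrightarrow> c3 < c4 \<Longrightarrow>
     (a, c1) \<in> X \<Longrightarrow> (b, c2) \<in> X \<Longrightarrow> (a, c3) \<in> X \<Longrightarrow> (b, c4) \<in> X \<Longrightarrow> False) \<Longrightarrow> abab_free X"
  by (auto simp: abab_free_def)

lemma abab_freeD:
  "abab_free X \<Longrightarrow> a < b \<Longrightarrow> c1 < c2 \<Longrightarrow> c2 < c3 \<Longrightarrow> c3 < c4 \<Longrightarrow>
     (a, c1) \<in> X \<Longrightarrow> (b, c2) \<in> X \<Longrightarrow> (a, c3) \<in> X \<Longrightarrow> (b, c4) \<in> X \<Longrightarrow> False"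
  unfolding abab_free_def by blast

text \<open>The columns in \<open>\<Phi>\<close> are the fans: each row has its first one in exactly one of them, and the
  rows starting in a common fan of size \<open>m\<close> are exhausted one after the other, the lower ones
  (with larger index) first.\<close>

definition fan_matrix :: "nat \<Rightarrow> (nat \<times> nat) set \<Rightarrow> nat set \<Rightarrow> bool" where
  "fan_matrix m X \<Phi> \<longleftrightarrow> finite X \<and> finite \<Phi> \<and> abab_free X \<and>
     (\<forall>\<phi>\<in>\<Phi>. card {r. (r, \<phi>) \<in> X} = m) \<and>
     (\<forall>r c. (r, c) \<in> X \<longrightarrow> (\<exists>\<phi>\<in>\<Phi>. (r, \<phi>) \<in> X)) \<and>
     (\<forall>\<phi>\<in>\<Phi>. \<forall>r c. (r, \<phi>) \<in> X \<longrightarrow> (r, c) \<in> X \<longrightarrow> \<phi> \<le> c) \<and>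
     (\<forall>\<phi>\<in>\<Phi>. \<forall>a b c c'. a < b \<longrightarrow> (a, \<phi>) \<in> X \<longrightarrow> (b, \<phi>) \<in> X \<longrightarrow>
        (a, c) \<in> X \<longrightarrow> (b, c') \<in> X \<longrightarrow> \<phi> < c \<longrightarrow> \<phi> < c' \<longrightarrow> c' < c)"

lemma fan_matrixD:
  assumes "fan_matrix m X \<Phi>"
  shows "finite X" "finite \<Phi>" "abab_free X"
    "\<And>\<phi>. \<phi> \<in> \<Phi> \<Longrightarrow> card {r. (r, \<phi>) \<in> X} = m"
    "\<And>r c. (r, c) \<in> X \<Longrightarrow> \<exists>\<phi>\<in>\<Phi>. (r, \<phi>) \<in> X"
    "\<And>\<phi> r c. \<phi> \<in> \<Phi> \<Longrightarrow> (r, \<phi>) \<in> X \<Longrightarrow> (r, c) \<in> X \<Longrightarrow> \<phi> \<le> c"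
    "\<And>\<phi> a b c c'. \<phi> \<in> \<Phi> \<Longrightarrow> a < b \<Longrightarrow> (a, \<phi>) \<in> X \<Longrightarrow> (b, \<phi>) \<in> X \<Longrightarrow>
        (a, c) \<in> X \<Longrightarrow> (b, c') \<in> X \<Longrightarrow> \<phi> < c \<Longrightarrow> \<phi> < c' \<Longrightarrow> c' < c"
proof -
  note a = assms[unfolded fan_matrix_def]
  show "finite X" "finite \<Phi>" "abab_free X" using a by blast+
  show "\<And>\<phi>. \<phi> \<in> \<Phi> \<Longrightarrow> card {r. (r, \<phi>) \<in> X} = m" using a by (elim conjE) blast
  show "\<And>r c. (r, c) \<in> X \<Longrightarrow> \<exists>\<phi>\<in>\<Phi>. (r, \<phi>) \<in> X" using a by (elim conjE) blast
  show "\<And>\<phi> r c. \<phi> \<in> \<Phi> \<Longrightarrow> (r, \<phi>) \<in> X \<Longrightarrow> (r, c) \<in> X \<Longrightarrow> \<phi> \<le> c" using a by (elim conjE) blast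
  show "\<And>\<phi> a b c c'. \<phi> \<in> \<Phi> \<Longrightarrow> a < b \<Longrightarrow> (a, \<phi>) \<in> X \<Longrightarrow> (b, \<phi>) \<in> X \<Longrightarrow>
        (a, c) \<in> X \<Longrightarrow> (b, c') \<in> X \<Longrightarrow> \<phi> < c \<Longrightarrow> \<phi> < c' \<Longrightarrow> c' < c" using a by (elim conjE) blast
qed

text \<open>The minimum of \<open>A\<close> is matched with the maximum of \<open>B\<close>. The map
  assigns the rows of a fan of \<open>Y\<close> to the fans of a copy of \<open>X\<close>, those
  with larger index to the earlier fans.\<close>

lemma strict_antimono_bij_exists:
  fixes A B :: "nat set"
  assumes "finite A" "finite B" "card A = card B"
  shows "\<exists>h. bij_betw h A B \<and> (\<forall>x\<in>A. \<forall>y\<in>A. x < y \<longrightarrow> h y < h x)"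
  using assms
proof (induction "card A" arbitrary: A B)
  case 0
  then show ?case by (auto simp: bij_betw_def)
next
  case (Suc n)
  let ?a = "Min A" and ?b = "Max B"
  have ne: "A \<noteq> {}" "B \<noteq> {}" using Suc by auto
  have ab: "?a \<in> A" "?b \<in> B" using ne Suc by auto
  obtain h where h: "bij_betw h (A - {?a}) (B - {?b})"
    "\<forall>x\<in>A - {?a}. \<forall>y\<in>A - {?a}. x < y \<longrightarrow> h y < h x"
  proof -
    have "n = card (A - {?a})" "card (A - {?a}) = card (B - {?b})"
      using Suc.hyps(2) Suc.prems ab by simp_all
    then show ?thesis
      using Suc.hyps(1)[of "A - {?a}" "B - {?b}"] Suc.prems that by blast
  qed
  have hB: "h x \<in> B \<and> h x \<noteq> ?b" if "x \<in> A" "x \<noteq> ?a" for x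
    using bij_betwE[OF h(1)] that by auto
  define h' where "h' = h(?a := ?b)"
  have "bij_betw h' (A - {?a}) (B - {?b})"
    using h(1) by (subst bij_betw_cong[of _ h' h]) (auto simp: h'_def)
  then have "bij_betw h' (insert ?a (A - {?a})) (insert ?b (B - {?b}))"
    using notIn_Un_bij_betw[of ?a "A - {?a}" h' "B - {?b}"] by (simp add: h'_def)
  then have "bij_betw h' A B" using ab by (simp add: insert_absorb)
  moreover have "h' y < h' x" if xy: "x \<in> A" "y \<in> A" "x < y" for x y
  proof -
    have y: "y \<noteq> ?a" using Min_le[OF Suc.prems(1) xy(1)] xy by auto
    show ?thesis
    proof (cases "x = ?a")
      case True
      have "h y \<le> ?b" using hB[OF xy(2) y] Suc.prems(2) by simp
      then show ?thesis using True y hB[OF xy(2) y] by (simp add: h'_def)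
    next
      case False
      then show ?thesis using h(2) xy y by (simp add: h'_def)
    qed
  qed
  ultimately show ?case by blast
qed

section \<open>The recursive step for fan matrices\<close>

lemma less_of_div_less: "(c :: nat) div L < c' div L \<Longrightarrow> c < c'"
  by (meson div_le_mono leD leI)

lemma less_iff_mod_less: "(c :: nat) div L = c' div L \<Longrightarrow> c < c' \<longleftrightarrow> c mod L < c' mod L"
  by (metis add_less_cancel_left div_mult_mod_eq)

text \<open>Each fan of \<open>Y\<close> is preceded by a copy of \<open>X\<close>, and the rows starting in that fan get
  an additional one in the fans of the copy, one in each. Column \<open>c\<close> of \<open>Y\<close>
  becomes \<open>c * L + W\<close>; the copy in front of it occupies the \<open>W\<close> columns before.\<close>

locale fan_step =
  fixes m :: nat and X Y :: "(nat \<times> nat) set" and \<Phi> \<Psi> :: "nat set"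
    and W R R' :: nat and h :: "nat \<Rightarrow> nat \<Rightarrow> nat"
  assumes m: "0 < m"
    and X: "fan_matrix m X \<Phi>" and Y: "fan_matrix (card \<Phi>) Y \<Psi>"
    and X_bound: "\<And>r c. (r, c) \<in> X \<Longrightarrow> r < R' \<and> c < W"
    and Y_bound: "\<And>r c. (r, c) \<in> Y \<Longrightarrow> r < R"
    and h_bij: "\<And>q. q \<in> \<Psi> \<Longrightarrow> bij_betw (h q) {r. (r, q) \<in> Y} \<Phi>"
    and h_anti: "\<And>q a b. q \<in> \<Psi> \<Longrightarrow> (a, q) \<in> Y \<Longrightarrow> (b, q) \<in> Y \<Longrightarrow> a < b \<Longrightarrow> h q b < h q a"
begin

definition L :: nat where "L = Suc W"

text \<open>Row \<open>R + q * R' + x\<close> is row \<open>x\<close> of the copy in front of the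
  fan \<open>q\<close>. Copies come after the rows of \<open>Y\<close> because a new fan must
  exhaust its rows of larger index first, and a copy ends before the main column of its
  block.\<close>

definition Z :: "(nat \<times> nat) set" where
  "Z = {(r, c). if r < R
        then (r, c div L) \<in> Y \<and> (c mod L = W \<or> c div L \<in> \<Psi> \<and> c mod L = h (c div L) r)
        else c div L \<in> \<Psi> \<and> (r - R) div R' = c div L \<and> ((r - R) mod R', c mod L) \<in> X}"

text \<open>Only the fans of the copies remain fans: every row of \<open>Y\<close> now starts with
  its additional one.\<close>

definition \<Theta> :: "nat set" where
  "\<Theta> = (\<lambda>(q, \<phi>). q * L + \<phi>) ` (\<Psi> \<times> \<Phi>)"

lemma \<Phi>_bound: "\<phi> \<in> \<Phi> \<Longrightarrow> \<phi> < W"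
proof -
  assume "\<phi> \<in> \<Phi>"
  then have "{r. (r, \<phi>) \<in> X} \<noteq> {}" using fan_matrixD(4)[OF X] m by (metis card.empty less_irrefl)
  then show ?thesis using X_bound by auto
qed

lemma h_in: "q \<in> \<Psi> \<Longrightarrow> (r, q) \<in> Y \<Longrightarrow> h q r \<in> \<Phi>"
  using h_bij bij_betwE by blast

lemma h_less: "q \<in> \<Psi> \<Longrightarrow> (r, q) \<in> Y \<Longrightarrow> h q r < W"
  using h_in \<Phi>_bound by blast

lemma div_mod_L [simp]: "x < W \<Longrightarrow> (q * L + x) div L = q" "x < W \<Longrightarrow> (q * L + x) mod L = x"
  "(q * L + W) div L = q" "(q * L + W) mod L = W"
  by (auto simp: L_def div_mult_self3 simp del: mult_Suc_right)

lemma L_simps [simp]: "L \<noteq> 0" "x < W \<Longrightarrow> x div L = 0" "x < W \<Longrightarrow> x mod L = x" "W div L = 0" "W mod L = W"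
  by (simp_all add: L_def)

lemma in_Z_low: "r < R \<Longrightarrow> (r, c) \<in> Z \<longleftrightarrow>
    (r, c div L) \<in> Y \<and> (c mod L = W \<or> c div L \<in> \<Psi> \<and> c mod L = h (c div L) r)"
  by (simp add: Z_def)

lemma in_Z_high: "\<not> r < R \<Longrightarrow> (r, c) \<in> Z \<longleftrightarrow>
    c div L \<in> \<Psi> \<and> (r - R) div R' = c div L \<and> ((r - R) mod R', c mod L) \<in> X"
  by (simp add: Z_def)

lemma mod_L_le: "c mod L \<le> W" by (simp add: L_def less_Suc_eq_le[symmetric] del: less_Suc_eq_le)

text \<open>Two rows of copies can alternate only inside one copy, that is, in \<open>X\<close>; two
  rows of \<open>Y\<close> with four different blocks would alternate in \<open>Y\<close>. What
  remains are blocks shared by several of the four columns.\<close>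

lemma abab_free_Z: "abab_free Z"
proof (rule abab_freeI)
  fix a b c1 c2 c3 c4
  assume ab: "a < b" and lt: "c1 < c2" "c2 < c3" "c3 < c4"
    and Z: "(a, c1) \<in> Z" "(b, c2) \<in> Z" "(a, c3) \<in> Z" "(b, c4) \<in> Z"
  have le: "c1 div L \<le> c2 div L" "c2 div L \<le> c3 div L" "c3 div L \<le> c4 div L"
    using lt by (simp_all add: div_le_mono)
  note md = less_iff_mod_less[of _ L]
  consider "b < R" | "a < R" "\<not> b < R" | "\<not> a < R" "\<not> b < R" using ab by linarith
  then show False
  proof cases
    case 1
    then have "a < R" using ab by simp
    note za = in_Z_low[OF this] and zb = in_Z_low[OF 1]
    have Y': "(a, c1 div L) \<in> Y" "(b, c2 div L) \<in> Y" "(a, c3 div L) \<in> Y" "(b, c4 div L) \<in> Y"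
      using Z za zb by auto
    consider "c1 div L < c2 div L" "c2 div L < c3 div L" "c3 div L < c4 div L"
      | "c1 div L = c2 div L" | "c1 div L < c2 div L" "c2 div L = c3 div L"
      | "c1 div L < c2 div L" "c2 div L < c3 div L" "c3 div L = c4 div L"
      using le by linarith
    then show False
    proof cases
      case 1
      show False by (rule abab_freeD[OF fan_matrixD(3)[OF Y] ab 1 Y'])
    next
      \<comment> \<open>Here \<open>c1\<close> is the additional one of \<open>a\<close>, so the
        common block is a fan. If \<open>c3\<close> lies in it too, \<open>c2\<close> is the
        additional one of \<open>b\<close>, which comes before that of \<open>a\<close>; otherwise
        the order of exhaustion in \<open>Y\<close> puts \<open>c4\<close> before
        \<open>c3\<close>.\<close>
      case 2
      let ?q = "c2 div L"
      have s12: "c1 mod L < c2 mod L" using md[OF 2] lt by simp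
      then have "c1 mod L \<noteq> W" using mod_L_le[of c2] by simp
      then have q: "?q \<in> \<Psi>" "c1 mod L = h ?q a" using Z(1) za 2 by auto
      show False
      proof (cases "c3 div L = ?q")
        case True
        then have "c2 mod L < c3 mod L" using md[of c2 c3] lt by simp
        then have "c2 mod L = h ?q b" using Z(2) zb mod_L_le[of c3] by auto
        moreover have "h ?q b < h ?q a" using h_anti[OF q(1) _ Y'(2) ab] Y'(1) 2 by simp
        ultimately show False using s12 q by simp
      next
        case False
        then have "?q < c3 div L" using le by simp
        moreover from this have "?q < c4 div L" using le by simp
        ultimately have "c4 div L < c3 div L"
          using fan_matrixD(7)[OF Y q(1) ab _ Y'(2) Y'(3) Y'(4)] Y'(1) 2 by simp
        then show False using le by simp
      qed
    next
      \<comment> \<open>A one followed by another column of the same block is an additional one, so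
        the block is a fan and \<open>a\<close> starts there, contrary to the earlier
        \<open>c1\<close>. The next case is similar.\<close>
      case 3
      then have "c2 mod L < c3 mod L" using md[of c2 c3] lt by simp
      then have "c2 div L \<in> \<Psi>" using Z(2) zb mod_L_le[of c3] by auto
      then have "c2 div L \<le> c1 div L" using fan_matrixD(6)[OF Y, of "c2 div L" a] Y' 3 by simp
      then show False using 3 by simp
    next
      case 4
      then have "c3 mod L < c4 mod L" using md[of c3 c4] lt by simp
      then have "c3 div L \<in> \<Psi>" using Z(3) za mod_L_le[of c4] by auto
      then have "c3 div L \<le> c1 div L" using fan_matrixD(6)[OF Y _ Y'(3) Y'(1)] by simp
      then show False using 4 by simp
    qed
  next
    \<comment> \<open>Both ones of \<open>b\<close> lie in one block, before its main column. Hence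
      \<open>c3\<close> is the additional one of \<open>a\<close>, and so is \<open>c1\<close>, as
      \<open>a\<close> starts in this fan.\<close>
    case 2
    note za = in_Z_low[OF 2(1)] and zb = in_Z_high[OF 2(2)]
    have q: "c2 div L = c4 div L" "c2 div L \<in> \<Psi>" "((b - R) mod R', c4 mod L) \<in> X"
      using Z zb by auto
    then have q3: "c3 div L = c2 div L" using le by simp
    have "c4 mod L < W" using X_bound q by blast
    then have s3: "c3 mod L < W" using md[of c3 c4] q q3 lt by simp
    then have h3: "c3 mod L = h (c2 div L) a" "(a, c2 div L) \<in> Y" using Z(3) za q3 by auto
    have "(a, c1 div L) \<in> Y" using Z(1) za by simp
    then have q1: "c1 div L = c2 div L" using fan_matrixD(6)[OF Y q(2) h3(2)] le by fastforce
    then have "c1 mod L < c3 mod L" using md[of c1 c3] q3 lt by simp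
    moreover from this have "c1 mod L = h (c2 div L) a" using Z(1) za q1 s3 by auto
    ultimately show False using h3 by simp
  next
    case 3
    note za = in_Z_high[OF 3(1)] and zb = in_Z_high[OF 3(2)]
    have q: "c1 div L = c3 div L" "c2 div L = c4 div L" "(a - R) div R' = c1 div L"
      "(b - R) div R' = c2 div L"
      using Z za zb by auto
    then have eq: "c2 div L = c1 div L" "c3 div L = c1 div L" "c4 div L = c1 div L"
      using le by simp_all
    have "a - R < b - R" using ab 3 by simp
    moreover have "(a - R) div R' = (b - R) div R'" using q(3,4) eq(1) by simp
    ultimately have "(a - R) mod R' < (b - R) mod R'" by (simp only: less_iff_mod_less)
    moreover have "c1 mod L < c2 mod L" "c2 mod L < c3 mod L" "c3 mod L < c4 mod L"
      using md[of c1 c2] md[of c2 c3] md[of c3 c4] eq(1) eq(2,3)[folded eq(1)] lt by auto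
    ultimately show False using abab_freeD[OF fan_matrixD(3)[OF X]] Z za zb by blast
  qed
qed

text \<open>The three kinds of ones, for counting: main columns, copies, additional ones.\<close>

lemma Z_eq:
  "Z = (\<lambda>(r, c). (r, c * L + W)) ` Y \<union>
     (\<lambda>(q, x, y). (R + (q * R' + x), q * L + y)) ` (\<Psi> \<times> X) \<union>
     (\<lambda>(q, r). (r, q * L + h q r)) ` (SIGMA q:\<Psi>. {r. (r, q) \<in> Y})"
  (is "_ = ?A \<union> ?B \<union> ?C")
proof (intro equalityI subsetI)
  fix z assume z: "z \<in> Z"
  obtain r c where rc: "z = (r, c)" by (cases z)
  define q s where "q = c div L" and "s = c mod L"
  have c: "c = q * L + s" by (simp add: q_def s_def)
  show "z \<in> ?A \<union> ?B \<union> ?C"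
  proof (cases "r < R")
    case True
    then have "(r, q) \<in> Y" "s = W \<or> q \<in> \<Psi> \<and> s = h q r"
      using z rc in_Z_low by (auto simp: q_def s_def)
    then show ?thesis unfolding rc c by force
  next
    case False
    define x where "x = (r - R) mod R'"
    have "q \<in> \<Psi>" "(r - R) div R' = q" "(x, s) \<in> X"
      using z rc in_Z_high[OF False] by (auto simp: q_def s_def x_def)
    moreover from this have "r = R + (q * R' + x)"
      using False div_mult_mod_eq[of "r - R" R'] by (simp add: x_def)
    ultimately show ?thesis unfolding rc c by force
  qed
next
  fix z assume "z \<in> ?A \<union> ?B \<union> ?C"
  then consider r c where "z = (r, c * L + W)" "(r, c) \<in> Y"
    | q x y where "z = (R + (q * R' + x), q * L + y)" "q \<in> \<Psi>" "(x, y) \<in> X"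
    | q r where "z = (r, q * L + h q r)" "q \<in> \<Psi>" "(r, q) \<in> Y"
    by auto
  then show "z \<in> Z"
  proof cases
    case 1
    then show ?thesis using Y_bound by (simp add: in_Z_low)
  next
    case 2
    then have "x < R'" "y < W" using X_bound by auto
    then show ?thesis using 2 by (simp add: in_Z_high div_mult_self3)
  next
    case 3
    then show ?thesis using Y_bound by (simp add: in_Z_low h_less)
  qed
qed

lemma finite_Z: "finite Z"
proof -
  have "finite {r. (r, q) \<in> Y}" for q
    by (rule finite_subset[of _ "fst ` Y"]) (use fan_matrixD(1)[OF Y] in force)+
  then show ?thesis
    using fan_matrixD(1,2)[OF X] fan_matrixD(1,2)[OF Y] by (simp add: Z_eq)
qed

lemma card_cols_Z: "card (snd ` Z) \<le> card (snd ` Y) + card \<Psi> * card (snd ` X)"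
proof -
  have "snd ` Z \<subseteq> (\<lambda>c. c * L + W) ` snd ` Y \<union> (\<lambda>(q, y). q * L + y) ` (\<Psi> \<times> snd ` X)"
  proof
    fix c assume "c \<in> snd ` Z"
    then consider r c' where "c = c' * L + W" "(r, c') \<in> Y"
      | q x y where "c = q * L + y" "q \<in> \<Psi>" "(x, y) \<in> X"
      | q r where "c = q * L + h q r" "q \<in> \<Psi>" "(r, q) \<in> Y"
      unfolding Z_eq by auto
    then show "c \<in> (\<lambda>c. c * L + W) ` snd ` Y \<union> (\<lambda>(q, y). q * L + y) ` (\<Psi> \<times> snd ` X)"
    proof cases
      case 3
      then have "{r'. (r', h q r) \<in> X} \<noteq> {}"
        using fan_matrixD(4)[OF X h_in] m by (metis card.empty less_irrefl)
      then have "h q r \<in> snd ` X" by force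
      then show ?thesis using 3 by auto
    qed force+
  qed
  moreover have fin: "finite (snd ` Y)" "finite (\<Psi> \<times> snd ` X)"
    using fan_matrixD(1,2)[OF X] fan_matrixD(1,2)[OF Y] by auto
  ultimately have "card (snd ` Z) \<le> card ((\<lambda>c. c * L + W) ` snd ` Y) +
      card ((\<lambda>(q, y). q * L + y) ` (\<Psi> \<times> snd ` X))"
    by (meson card_Un_le card_mono finite_UnI finite_imageI le_trans)
  then show ?thesis
    using card_image_le[OF fin(1), of "\<lambda>c. c * L + W"]
      card_image_le[OF fin(2), of "\<lambda>(q, y). q * L + y"]
    by (simp add: card_cartesian_product)
qed

lemma card_Z: "card Z = card Y + card \<Psi> * card X + card \<Psi> * card \<Phi>"
proof -
  let ?a = "\<lambda>(r, c). (r, c * L + W)" and ?b = "\<lambda>(q, x, y). (R + (q * R' + x), q * L + y)"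
    and ?c = "\<lambda>(q, r). (r, q * L + h q r)"
  let ?S = "SIGMA q:\<Psi>. {r. (r, q) \<in> Y}"
  have fin: "finite Y" "finite (\<Psi> \<times> X)" "finite ?S"
  proof -
    have "finite {r. (r, q) \<in> Y}" for q
      by (rule finite_subset[of _ "fst ` Y"]) (use fan_matrixD(1)[OF Y] in force)+
    then show "finite Y" "finite (\<Psi> \<times> X)" "finite ?S"
      using fan_matrixD(1,2)[OF X] fan_matrixD(1,2)[OF Y] by auto
  qed
  have "inj_on ?a Y" by (auto simp: inj_on_def)
  moreover have "inj_on ?b (\<Psi> \<times> X)"
  proof (rule inj_onI)
    fix u v assume uv: "u \<in> \<Psi> \<times> X" "v \<in> \<Psi> \<times> X" "?b u = ?b v"
    obtain q x y q' x' y' where u: "u = (q, x, y)" "v = (q', x', y')" by (metis surj_pair)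
    then have "y < W" "y' < W" using uv X_bound by auto
    moreover have eq: "q * L + y = q' * L + y'" "q * R' + x = q' * R' + x'" using uv u by auto
    ultimately have "q = q'" by (metis div_mod_L(1))
    then show "u = v" using eq u by simp
  qed
  moreover have "inj_on ?c ?S"
  proof (rule inj_onI)
    fix u v assume uv: "u \<in> ?S" "v \<in> ?S" "?c u = ?c v"
    obtain q r q' r' where u: "u = (q, r)" "v = (q', r')" by (metis surj_pair)
    then have "h q r < W" "h q' r' < W" using uv h_less by auto
    moreover have eq: "q * L + h q r = q' * L + h q' r'" "r = r'" using uv u by auto
    ultimately have "q = q'" by (metis div_mod_L(1))
    then show "u = v" using eq u by simp
  qed
  ultimately have c: "card (?a ` Y) = card Y" "card (?b ` (\<Psi> \<times> X)) = card \<Psi> * card X"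
    "card (?c ` ?S) = card ?S"
    by (simp_all only: card_image card_cartesian_product)
  have "card ?S = (\<Sum>q\<in>\<Psi>. card \<Phi>)"
  proof -
    have "finite {r. (r, q) \<in> Y}" for q
      by (rule finite_subset[of _ "fst ` Y"]) (use fan_matrixD(1)[OF Y] in force)+
    then show ?thesis using fan_matrixD(2,4)[OF Y] by (simp add: card_SigmaI)
  qed
  then have S: "card ?S = card \<Psi> * card \<Phi>" by simp
  have "?a ` Y \<inter> ?b ` (\<Psi> \<times> X) = {}" using Y_bound by fastforce
  moreover have "(?a ` Y \<union> ?b ` (\<Psi> \<times> X)) \<inter> ?c ` ?S = {}"
  proof -
    have "(r, c * L + W) \<noteq> (r', q * L + h q r')" if "q \<in> \<Psi>" "(r', q) \<in> Y" for r c r' q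
      using h_less[OF that] by (metis div_mod_L(2,4) less_irrefl prod.inject)
    moreover have "R + x \<noteq> r'" if "(r', q) \<in> Y" for r' q x using Y_bound[OF that] by simp
    ultimately show ?thesis by fastforce
  qed
  ultimately show ?thesis
    unfolding Z_eq using fin c S by (simp only: card_Un_disjoint finite_UnI finite_imageI)
qed

lemma card_\<Theta>: "card \<Theta> = card \<Psi> * card \<Phi>"
proof -
  have "inj_on (\<lambda>(q, \<phi>). q * L + \<phi>) (\<Psi> \<times> \<Phi>)"
  proof (rule inj_onI)
    fix u v assume uv: "u \<in> \<Psi> \<times> \<Phi>" "v \<in> \<Psi> \<times> \<Phi>"
      "(case u of (q, \<phi>) \<Rightarrow> q * L + \<phi>) = (case v of (q, \<phi>) \<Rightarrow> q * L + \<phi>)"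
    obtain q r q' r' where u: "u = (q, r)" "v = (q', r')" by (metis surj_pair)
    then have "r < W" "r' < W" using uv \<Phi>_bound by auto
    moreover have "q * L + r = q' * L + r'" using uv u by auto
    ultimately show "u = v" unfolding u by (metis div_mod_L(1,2))
  qed
  then show ?thesis by (simp add: \<Theta>_def card_image card_cartesian_product)
qed

lemma in_\<Theta>: "\<theta> \<in> \<Theta> \<Longrightarrow> \<theta> div L \<in> \<Psi> \<and> \<theta> mod L \<in> \<Phi> \<and> \<theta> mod L < W"
  by (auto simp: \<Theta>_def \<Phi>_bound)

lemma \<Theta>_iff: "\<theta> \<in> \<Theta> \<longleftrightarrow> \<theta> div L \<in> \<Psi> \<and> \<theta> mod L \<in> \<Phi>"
proof
  assume "\<theta> div L \<in> \<Psi> \<and> \<theta> mod L \<in> \<Phi>"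
  then show "\<theta> \<in> \<Theta>"
    unfolding \<Theta>_def by (intro image_eqI[of _ _ "(\<theta> div L, \<theta> mod L)"]) auto
qed (use in_\<Theta> in blast)

text \<open>A fan of a copy keeps its \<open>m\<close> rows and gains exactly one row of
  \<open>Y\<close>, since \<open>h q\<close> is a bijection.\<close>

lemma card_fan_Z:
  assumes "\<theta> \<in> \<Theta>" shows "card {r. (r, \<theta>) \<in> Z} = Suc m"
proof -
  let ?q = "\<theta> div L" and ?\<phi> = "\<theta> mod L"
  have \<theta>: "?q \<in> \<Psi>" "?\<phi> \<in> \<Phi>" "?\<phi> < W" using in_\<Theta>[OF assms] by auto
  have "?\<phi> \<in> h ?q ` {r. (r, ?q) \<in> Y}"
    using bij_betw_imp_surj_on[OF h_bij[OF \<theta>(1)]] \<theta>(2) by simp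
  then obtain r0 where r0: "(r0, ?q) \<in> Y" "h ?q r0 = ?\<phi>" by auto
  have uniq: "r = r0" if "(r, ?q) \<in> Y" "h ?q r = ?\<phi>" for r
    using inj_onD[OF bij_betw_imp_inj_on[OF h_bij[OF \<theta>(1)]], of r r0] r0 that by simp
  have "{r. (r, \<theta>) \<in> Z} = insert r0 ((\<lambda>x. R + (?q * R' + x)) ` {x. (x, ?\<phi>) \<in> X})"
  proof (intro equalityI subsetI)
    fix r assume "r \<in> {r. (r, \<theta>) \<in> Z}"
    then have r: "(r, \<theta>) \<in> Z" by simp
    show "r \<in> insert r0 ((\<lambda>x. R + (?q * R' + x)) ` {x. (x, ?\<phi>) \<in> X})"
    proof (cases "r < R")
      case True
      then show ?thesis using r in_Z_low[OF True] uniq \<theta>(3) by auto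
    next
      case False
      then have "(r - R) div R' = ?q" "((r - R) mod R', ?\<phi>) \<in> X" using r in_Z_high by auto
      moreover from this have "r = R + (?q * R' + (r - R) mod R')"
        using False div_mult_mod_eq[of "r - R" R'] by simp
      ultimately show ?thesis by blast
    qed
  next
    fix r assume "r \<in> insert r0 ((\<lambda>x. R + (?q * R' + x)) ` {x. (x, ?\<phi>) \<in> X})"
    then consider "r = r0" | x where "r = R + (?q * R' + x)" "(x, ?\<phi>) \<in> X" by auto
    then show "r \<in> {r. (r, \<theta>) \<in> Z}"
    proof cases
      case 1
      then show ?thesis using in_Z_low[OF Y_bound[OF r0(1)]] r0 \<theta>(1) by simp
    next
      case 2
      then show ?thesis using X_bound[OF 2(2)] \<theta>(1) by (simp add: in_Z_high div_mult_self3)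
    qed
  qed
  moreover have "r0 \<notin> (\<lambda>x. R + (?q * R' + x)) ` {x. (x, ?\<phi>) \<in> X}"
    using Y_bound[OF r0(1)] by auto
  moreover have "finite {x. (x, ?\<phi>) \<in> X}"
    by (rule finite_subset[of _ "fst ` X"]) (use fan_matrixD(1)[OF X] in force)+
  ultimately show ?thesis
    using fan_matrixD(4)[OF X \<theta>(2)] by (simp add: card_image inj_on_def)
qed

lemma fan_first_Z:
  assumes "\<theta> \<in> \<Theta>" "(r, \<theta>) \<in> Z" "(r, c) \<in> Z"
  shows "\<theta> \<le> c"
proof (rule ccontr)
  assume "\<not> ?thesis"
  then have lt: "c < \<theta>" by simp
  then have le: "c div L \<le> \<theta> div L" by (simp add: div_le_mono)
  have \<theta>: "\<theta> div L \<in> \<Psi>" "\<theta> mod L \<in> \<Phi>" "\<theta> mod L < W" using in_\<Theta>[OF assms(1)] by auto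
  show False
  proof (cases "r < R")
    case True
    have r: "(r, \<theta> div L) \<in> Y" "\<theta> mod L = h (\<theta> div L) r" "(r, c div L) \<in> Y"
      using assms(2,3) in_Z_low[OF True] \<theta>(3) by auto
    then have eq: "c div L = \<theta> div L" using fan_matrixD(6)[OF Y \<theta>(1) r(1,3)] le by simp
    then have "c mod L < \<theta> mod L" using less_iff_mod_less[OF eq] lt by simp
    then show False using assms(3) in_Z_low[OF True] eq r(2) \<theta>(3) by auto
  next
    case False
    then have eq: "c div L = \<theta> div L" using assms(2,3) in_Z_high by auto
    then have "c mod L < \<theta> mod L" using less_iff_mod_less[OF eq] lt by simp
    moreover have "\<theta> mod L \<le> c mod L"
      using fan_matrixD(6)[OF X \<theta>(2)] assms(2,3) in_Z_high[OF False] by blast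
    ultimately show False by simp
  qed
qed

text \<open>Two rows of \<open>Y\<close> never share a new fan, and two rows of a copy inherit the
  order from \<open>X\<close>. A row of \<open>Y\<close> returns at the earliest in the main column
  of the block, after the whole copy.\<close>

lemma fan_exhausted_Z:
  assumes \<theta>: "\<theta> \<in> \<Theta>" and ab: "a < b" and Z: "(a, \<theta>) \<in> Z" "(b, \<theta>) \<in> Z" "(a, c) \<in> Z" "(b, c') \<in> Z"
    and lt: "\<theta> < c" "\<theta> < c'"
  shows "c' < c"
proof -
  have q: "\<theta> div L \<in> \<Psi>" "\<theta> mod L \<in> \<Phi>" "\<theta> mod L < W" using in_\<Theta>[OF \<theta>] by auto
  consider "b < R" | "a < R" "\<not> b < R" | "\<not> a < R" "\<not> b < R" using ab by linarith
  then show ?thesis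
  proof cases
    case 1
    then have "a < R" using ab by simp
    then have "(a, \<theta> div L) \<in> Y" "(b, \<theta> div L) \<in> Y" "h (\<theta> div L) a = h (\<theta> div L) b"
      using Z(1,2) in_Z_low[OF 1] in_Z_low[of a] q(3) by auto
    then show ?thesis using h_anti[OF q(1) _ _ ab] by fastforce
  next
    case 2
    note za = in_Z_low[OF 2(1)] and zb = in_Z_high[OF 2(2)]
    have c': "c' div L = \<theta> div L" "c' mod L < W" using Z(2,4) zb X_bound by auto
    have a: "(a, \<theta> div L) \<in> Y" "h (\<theta> div L) a = \<theta> mod L" using Z(1) za q(3) by auto
    have le: "\<theta> div L \<le> c div L" using lt by (simp add: div_le_mono)
    show ?thesis
    proof (cases "c div L = \<theta> div L")
      case True
      then have "\<theta> mod L < c mod L" using less_iff_mod_less[of \<theta> L c] lt by simp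
      then have "c mod L = W" using Z(3) za True a(2) by auto
      then show ?thesis using less_iff_mod_less[of c' L c] c' True by simp
    next
      case False
      then show ?thesis using le c' by (intro less_of_div_less[of c' L c]) simp
    qed
  next
    case 3
    note za = in_Z_high[OF 3(1)] and zb = in_Z_high[OF 3(2)]
    have c: "c div L = \<theta> div L" "c' div L = \<theta> div L" using Z za zb by auto
    have "a - R < b - R" using ab 3 by simp
    moreover have "(a - R) div R' = (b - R) div R'" using Z za zb by auto
    ultimately have "(a - R) mod R' < (b - R) mod R'" by (simp only: less_iff_mod_less)
    moreover have "\<theta> mod L < c mod L" "\<theta> mod L < c' mod L"
      using less_iff_mod_less[of \<theta> L c] less_iff_mod_less[of \<theta> L c'] c lt by auto
    ultimately have "c' mod L < c mod L"
      using fan_matrixD(7)[OF X q(2)] Z za zb by blast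
    then show ?thesis using less_iff_mod_less[of c' L c] c by simp
  qed
qed

lemma fan_exists_Z:
  assumes "(r, c) \<in> Z" shows "\<exists>\<theta>\<in>\<Theta>. (r, \<theta>) \<in> Z"
proof (cases "r < R")
  case True
  then have "(r, c div L) \<in> Y" using assms in_Z_low by blast
  then obtain q where q: "q \<in> \<Psi>" "(r, q) \<in> Y" using fan_matrixD(5)[OF Y] by blast
  show ?thesis
    by (rule bexI[of _ "q * L + h q r"])
      (use q in \<open>auto simp: in_Z_low[OF True] \<Theta>_iff h_in h_less\<close>)
next
  case False
  then have c: "c div L \<in> \<Psi>" "(r - R) div R' = c div L" "((r - R) mod R', c mod L) \<in> X"
    using assms in_Z_high by auto
  obtain \<phi> where "\<phi> \<in> \<Phi>" "((r - R) mod R', \<phi>) \<in> X" using fan_matrixD(5)[OF X c(3)] by blast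
  then show ?thesis
    by (intro bexI[of _ "c div L * L + \<phi>"])
      (use c in \<open>auto simp: in_Z_high[OF False] \<Theta>_iff \<Phi>_bound\<close>)
qed

lemma fan_matrix_Z: "fan_matrix (Suc m) Z \<Theta>"
  unfolding fan_matrix_def
proof (intro conjI)
  show "finite \<Theta>" using fan_matrixD(2)[OF X] fan_matrixD(2)[OF Y] by (simp add: \<Theta>_def)
qed (use finite_Z abab_free_Z card_fan_Z fan_first_Z fan_exhausted_Z fan_exists_Z in blast)+

end

lemma fan_matrix_combine:
  assumes X: "fan_matrix m X \<Phi>" and Y: "fan_matrix (card \<Phi>) Y \<Psi>" and m: "0 < m"
  obtains Z \<Theta> where "fan_matrix (Suc m) Z \<Theta>" "card \<Theta> = card \<Psi> * card \<Phi>"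
    "card Z = card Y + card \<Psi> * card X + card \<Psi> * card \<Phi>"
    "card (snd ` Z) \<le> card (snd ` Y) + card \<Psi> * card (snd ` X)"
proof -
  have bound: "\<exists>N. \<forall>(r, c)\<in>T. r < N \<and> c < N" if T: "finite T" for T :: "(nat \<times> nat) set"
  proof -
    obtain N where "\<forall>x\<in>fst ` T \<union> snd ` T. x < N"
      using T by (metis finite_nat_set_iff_bounded finite_UnI finite_imageI)
    then have "r < N \<and> c < N" if "(r, c) \<in> T" for r c
      using that by (metis UnCI fst_conv image_eqI snd_conv)
    then show ?thesis by blast
  qed
  obtain W where W: "\<And>r c. (r, c) \<in> X \<Longrightarrow> r < W \<and> c < W"
    using bound[OF fan_matrixD(1)[OF X]] by auto
  obtain R where R: "\<And>r c. (r, c) \<in> Y \<Longrightarrow> r < R"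
    using bound[OF fan_matrixD(1)[OF Y]] by fastforce
  have fin: "finite {r. (r, q) \<in> Y}" for q
    by (rule finite_subset[of _ "fst ` Y"]) (use fan_matrixD(1)[OF Y] in force)+
  have "\<exists>h. bij_betw h {r. (r, q) \<in> Y} \<Phi> \<and>
      (\<forall>a\<in>{r. (r, q) \<in> Y}. \<forall>b\<in>{r. (r, q) \<in> Y}. a < b \<longrightarrow> h b < h a)" if "q \<in> \<Psi>" for q
    using strict_antimono_bij_exists[OF fin fan_matrixD(2)[OF X]] fan_matrixD(4)[OF Y that] by simp
  then obtain h where h: "\<And>q. q \<in> \<Psi> \<Longrightarrow> bij_betw (h q) {r. (r, q) \<in> Y} \<Phi> \<and>
      (\<forall>a\<in>{r. (r, q) \<in> Y}. \<forall>b\<in>{r. (r, q) \<in> Y}. a < b \<longrightarrow> h q b < h q a)"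
    by metis
  interpret fan_step m X Y \<Phi> \<Psi> W R W h
    by unfold_locales (use X Y m W R h in auto)
  show thesis by (rule that[OF fan_matrix_Z card_\<Theta> card_Z card_cols_Z])
qed

section \<open>Base cases and density of fan matrices\<close>

lemma fan_matrix_column: "fan_matrix m ({..<m} \<times> {0}) {0}"
  by (auto simp: fan_matrix_def abab_free_def)

text \<open>The rows occupy disjoint intervals of \<open>k\<close> columns, so no two interact, and
  the number \<open>N\<close> of fans can be chosen at will.\<close>

lemma fan_matrix_rows:
  assumes "0 < k"
  shows "fan_matrix 1 ((\<lambda>(r, i). (r, r * k + i)) ` ({..<N} \<times> {..<k})) ((\<lambda>r. r * k) ` {..<N})"
    (is "fan_matrix 1 ?X ?\<Phi>")
proof -
  have X: "(r, c) \<in> ?X \<longleftrightarrow> r < N \<and> c div k = r" for r c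
  proof
    assume "r < N \<and> c div k = r"
    then show "(r, c) \<in> ?X"
      using assms by (intro image_eqI[of _ _ "(r, c mod k)"]) auto
  qed (use assms in auto)
  show ?thesis
    unfolding fan_matrix_def
  proof (intro conjI ballI allI impI)
    show "abab_free ?X"
    proof (rule abab_freeI)
      fix a b c1 c2 c3 c4 :: nat
      assume "a < b" "c2 < c3" "(b, c2) \<in> ?X" "(a, c3) \<in> ?X"
      then show False using div_le_mono[of c2 c3 k] unfolding X by simp
    qed
    show "card {r. (r, \<phi>) \<in> ?X} = 1" if \<phi>: "\<phi> \<in> ?\<Phi>" for \<phi>
    proof -
      obtain r' where "\<phi> = r' * k" "r' < N" using \<phi> by auto
      then have "{r. (r, \<phi>) \<in> ?X} = {r'}" unfolding X using assms by auto
      then show ?thesis by simp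
    qed
    show "\<exists>\<phi>\<in>?\<Phi>. (r, \<phi>) \<in> ?X" if "(r, c) \<in> ?X" for r c
      using that assms unfolding X by (intro bexI[of _ "r * k"]) auto
    show "\<phi> \<le> c" if "\<phi> \<in> ?\<Phi>" "(r, \<phi>) \<in> ?X" "(r, c) \<in> ?X" for \<phi> r c
    proof -
      have "\<phi> = r * k" using that(1,2) assms unfolding X by auto
      moreover have "c div k = r" using that(3) unfolding X by simp
      ultimately show ?thesis by (metis div_times_less_eq_dividend)
    qed
    show "c' < c" if "a < b" "(a, \<phi>) \<in> ?X" "(b, \<phi>) \<in> ?X" for \<phi> a b c c'
      using that unfolding X by simp
  qed simp_all
qed

text \<open>The slack \<open>\<epsilon>\<close> in the number of columns is what keeps the ratio of columns to rows bounded
  while the weight of each row grows with \<open>k\<close>: the fans of \<open>Y\<close> in a step can be taken so large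
  that the \<open>k\<close> extra columns per fan are negligible.\<close>

lemma fan_matrix_dense:
  fixes \<epsilon> :: real
  assumes "0 < \<epsilon>" "0 < m"
  shows "\<exists>X \<Phi>. fan_matrix m X \<Phi> \<and> \<Phi> \<noteq> {} \<and> k * m * card \<Phi> \<le> card X \<and>
    real (card (snd ` X)) \<le> ((1 + \<epsilon>) * m + k) * card \<Phi>"
  using assms
proof (induction k arbitrary: \<epsilon> m)
  case 0
  have "snd ` ({..<m} \<times> {0 :: nat}) = {0}" using 0 by force
  moreover have "1 \<le> (1 + \<epsilon>) * real m" using 0 mult_mono[of 1 "1 + \<epsilon>" 1 "real m"] by simp
  ultimately show ?case
    by (intro exI[of _ "{..<m} \<times> {0}"] exI[of _ "{0}"]) (simp add: fan_matrix_column)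
next
  case (Suc k)
  note IH = Suc.IH and \<epsilon> = Suc.prems(1)
  \<comment> \<open>With at least \<open>N\<close> fans in \<open>X\<close>, the \<open>k\<close>
    columns per fan of \<open>Y\<close> cost at most \<open>\<epsilon> / 2\<close> times the number
    of fans of \<open>X\<close>.\<close>
  obtain N :: nat where N: "2 * real k / \<epsilon> + 1 \<le> real N" using real_arch_simple by blast
  have "0 \<le> 2 * real k / \<epsilon>" using Suc.prems by simp
  then have "0 < N" using N by (cases N) auto
  have "\<exists>X \<Phi>. fan_matrix m X \<Phi> \<and> N \<le> card \<Phi> \<and> Suc k * m * card \<Phi> \<le> card X \<and>
    real (card (snd ` X)) \<le> ((1 + \<epsilon>) * m + Suc k) * card \<Phi>"
    using Suc.prems(2)
  proof (induction m rule: nat_induct_non_zero)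
    case 1
    let ?X = "(\<lambda>(r, i). (r, r * Suc k + i)) ` ({..<N} \<times> {..<Suc k})"
      and ?\<Phi> = "(\<lambda>r. r * Suc k) ` {..<N}"
    have X: "card ?X = N * Suc k"
      by (subst card_image) (auto simp: inj_on_def card_cartesian_product)
    have \<Phi>: "card ?\<Phi> = N"
      by (subst card_image) (auto simp: inj_on_def simp del: mult_Suc_right)
    have "finite ?X" by simp
    then have "card (snd ` ?X) \<le> N * Suc k" using card_image_le[of ?X snd] by (simp only: X)
    then have "real (card (snd ` ?X)) \<le> real (N * Suc k)" by (rule of_nat_mono)
    also have "\<dots> = real N * real (Suc k)" by (rule of_nat_mult)
    also have "\<dots> \<le> ((1 + \<epsilon>) * real 1 + real (Suc k)) * real N"
      using Suc.prems(1) by (simp add: algebra_simps)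
    finally have "real (card (snd ` ?X)) \<le> ((1 + \<epsilon>) * real 1 + real (Suc k)) * real N" .
    then show ?case
      using fan_matrix_rows[of "Suc k" N] X \<Phi>
      by (intro exI[of _ ?X] exI[of _ ?\<Phi>]) (simp add: mult.commute)
  next
    case (Suc m)
    then obtain X \<Phi> where X: "fan_matrix m X \<Phi>" "N \<le> card \<Phi>" "Suc k * m * card \<Phi> \<le> card X"
      "real (card (snd ` X)) \<le> ((1 + \<epsilon>) * m + Suc k) * card \<Phi>" by blast
    have "0 < card \<Phi>" using X(2) \<open>0 < N\<close> by simp
    \<comment> \<open>Half of the slack goes to \<open>Y\<close>; the other half absorbs its
      \<open>k\<close> columns per fan.\<close>
    then obtain Y \<Psi> where Y: "fan_matrix (card \<Phi>) Y \<Psi>" "\<Psi> \<noteq> {}" "k * card \<Phi> * card \<Psi> \<le> card Y"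
      "real (card (snd ` Y)) \<le> ((1 + \<epsilon> / 2) * card \<Phi> + k) * card \<Psi>"
      using IH[of "\<epsilon> / 2" "card \<Phi>"] \<epsilon> by auto
    obtain Z \<Theta> where Z: "fan_matrix (Suc m) Z \<Theta>" "card \<Theta> = card \<Psi> * card \<Phi>"
      "card Z = card Y + card \<Psi> * card X + card \<Psi> * card \<Phi>"
      "card (snd ` Z) \<le> card (snd ` Y) + card \<Psi> * card (snd ` X)"
      using fan_matrix_combine[OF X(1) Y(1) Suc.hyps(1)] by metis
    have pos: "0 < card \<Psi>" using Y(2) fan_matrixD(2)[OF Y(1)] by (simp add: card_gt_0_iff)
    have "N \<le> card \<Theta>" using X(2) pos Z(2) by (simp add: trans_le_add1 Suc_le_eq le_trans[of N "card \<Phi>"])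
    \<comment> \<open>Per fan of \<open>Z\<close>, the matrix \<open>Y\<close> contributes
      \<open>k\<close>, the copies \<open>Suc k * m\<close> and the additional ones 1. That extra 1
      is what raises the weight from \<open>k\<close> to \<open>Suc k\<close>.\<close>
    moreover have "Suc k * Suc m * card \<Theta> \<le> card Z"
      using mult_le_mono2[OF X(3), of "card \<Psi>"] Y(3) unfolding Z(2,3)
      by (simp add: algebra_simps)
    moreover have "real (card (snd ` Z)) \<le> ((1 + \<epsilon>) * Suc m + Suc k) * card \<Theta>"
    proof -
      have "2 * real k / \<epsilon> \<le> real (card \<Phi>)" using N X(2) by linarith
      then have "real k \<le> \<epsilon> / 2 * card \<Phi>" using \<epsilon> by (simp add: field_simps)
      then have k: "real k * card \<Psi> \<le> \<epsilon> / 2 * card \<Phi> * card \<Psi>" by (intro mult_right_mono) auto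
      have "real (card (snd ` Z)) \<le> card (snd ` Y) + card \<Psi> * real (card (snd ` X))"
        using Z(4) by (metis of_nat_add of_nat_le_iff of_nat_mult)
      also have "\<dots> \<le> ((1 + \<epsilon> / 2) * card \<Phi> + k) * card \<Psi> +
          card \<Psi> * (((1 + \<epsilon>) * m + Suc k) * card \<Phi>)"
        using Y(4) X(4) by (intro add_mono mult_left_mono) auto
      also have "\<dots> = ((1 + \<epsilon>) * Suc m + Suc k) * card \<Theta> +
          (real k * card \<Psi> - \<epsilon> / 2 * card \<Phi> * card \<Psi>)"
        by (simp add: Z(2) algebra_simps)
      finally show ?thesis using k by simp
    qed
    ultimately show ?case using Z(1) by blast
  qed
  then obtain X \<Phi> where "fan_matrix m X \<Phi>" "N \<le> card \<Phi>" "Suc k * m * card \<Phi> \<le> card X"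
    "real (card (snd ` X)) \<le> ((1 + \<epsilon>) * m + Suc k) * card \<Phi>" by blast
  moreover from this have "\<Phi> \<noteq> {}" using \<open>0 < N\<close> by auto
  ultimately show ?case by blast
qed

section \<open>Square matrices of every size\<close>

lemma card_rows_fan_matrix_le:
  assumes "fan_matrix m X \<Phi>" shows "card (fst ` X) \<le> m * card \<Phi>"
proof -
  have fin: "finite {r. (r, q) \<in> X}" for q
    by (rule finite_subset[of _ "fst ` X"]) (use fan_matrixD(1)[OF assms] in force)+
  have "fst ` X \<subseteq> (\<Union>\<phi>\<in>\<Phi>. {r. (r, \<phi>) \<in> X})"
    using fan_matrixD(5)[OF assms] by fastforce
  then have "card (fst ` X) \<le> card (\<Union>\<phi>\<in>\<Phi>. {r. (r, \<phi>) \<in> X})"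
    using fan_matrixD(2)[OF assms] fin by (intro card_mono) auto
  also have "\<dots> \<le> (\<Sum>\<phi>\<in>\<Phi>. card {r. (r, \<phi>) \<in> X})"
    by (rule card_UN_le[OF fan_matrixD(2)[OF assms]])
  also have "\<dots> = m * card \<Phi>" using fan_matrixD(4)[OF assms] by simp
  finally show ?thesis .
qed

lemma rank_in_finite_set:
  fixes T :: "nat set"
  assumes "finite T" "card T \<le> p"
  obtains \<sigma> where "strict_mono_on T \<sigma>" "\<sigma> ` T \<subseteq> {..<p}"
proof
  let ?\<sigma> = "\<lambda>x. card {y \<in> T. y < x}"
  show "strict_mono_on T ?\<sigma>"
    unfolding strict_mono_on_def
    using assms(1) by (auto intro!: psubset_card_mono)
  have "?\<sigma> x < card T" if "x \<in> T" for x
    using that assms(1) by (auto intro!: psubset_card_mono)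
  then show "?\<sigma> ` T \<subseteq> {..<p}" using assms(2) by fastforce
qed

lemma abab_free_image:
  assumes "abab_free X" "strict_mono_on (fst ` X) \<sigma>" "strict_mono_on (snd ` X) \<tau>"
  shows "abab_free (map_prod \<sigma> \<tau> ` X)" "inj_on (map_prod \<sigma> \<tau>) X"
proof -
  have fst: "r \<in> fst ` X" and snd: "c \<in> snd ` X" if "(r, c) \<in> X" for r c
    using that by force+
  have less: "a < b" if "\<sigma> a < \<sigma> b" "a \<in> fst ` X" "b \<in> fst ` X" for a b
    using that assms(2) by (metis less_asym linorder_neqE_nat strict_mono_onD)
  have less': "a < b" if "\<tau> a < \<tau> b" "a \<in> snd ` X" "b \<in> snd ` X" for a b
    using that assms(3) by (metis less_asym linorder_neqE_nat strict_mono_onD)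
  have eq: "a = b" if "\<sigma> a = \<sigma> b" "a \<in> fst ` X" "b \<in> fst ` X" for a b
    using that strict_mono_on_imp_inj_on[OF assms(2)] by (auto dest: inj_onD)
  have eq': "a = b" if "\<tau> a = \<tau> b" "a \<in> snd ` X" "b \<in> snd ` X" for a b
    using that strict_mono_on_imp_inj_on[OF assms(3)] by (auto dest: inj_onD)
  show "abab_free (map_prod \<sigma> \<tau> ` X)"
  proof (rule abab_freeI)
    fix a b c1 c2 c3 c4
    assume lt: "a < b" "c1 < c2" "c2 < c3" "c3 < c4"
      and "(a, c1) \<in> map_prod \<sigma> \<tau> ` X" "(b, c2) \<in> map_prod \<sigma> \<tau> ` X"
        "(a, c3) \<in> map_prod \<sigma> \<tau> ` X" "(b, c4) \<in> map_prod \<sigma> \<tau> ` X"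
    then obtain a1 b2 a3 b4 d1 d2 d3 d4 where X: "(a1, d1) \<in> X" "(b2, d2) \<in> X" "(a3, d3) \<in> X" "(b4, d4) \<in> X"
      and e: "a = \<sigma> a1" "a = \<sigma> a3" "b = \<sigma> b2" "b = \<sigma> b4"
        "c1 = \<tau> d1" "c2 = \<tau> d2" "c3 = \<tau> d3" "c4 = \<tau> d4"
      by (auto simp: map_prod_def)
    have "a3 = a1" "b4 = b2" using eq e fst[OF X(1)] fst[OF X(2)] fst[OF X(3)] fst[OF X(4)] by metis+
    moreover have "a1 < b2" using less lt(1) e fst[OF X(1)] fst[OF X(2)] by metis
    moreover have "d1 < d2" "d2 < d3" "d3 < d4"
      using less' lt(2-) e snd[OF X(1)] snd[OF X(2)] snd[OF X(3)] snd[OF X(4)] by metis+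
    ultimately show False using abab_freeD[OF assms(1)] X by blast
  qed
  show "inj_on (map_prod \<sigma> \<tau>) X"
  proof (rule inj_onI)
    fix u v assume uv: "u \<in> X" "v \<in> X" "map_prod \<sigma> \<tau> u = map_prod \<sigma> \<tau> v"
    obtain a c b d where u: "u = (a, c)" "v = (b, d)" by (metis surj_pair)
    have "a = b" using eq[of a b] fst[of a c] fst[of b d] uv u by simp
    moreover have "c = d" using eq'[of c d] snd[of a c] snd[of b d] uv u by simp
    ultimately show "u = v" using u by simp
  qed
qed

lemma abab_free_dense:
  "\<exists>p X. 0 < p \<and> X \<subseteq> {..<p} \<times> {..<p} \<and> abab_free X \<and> K * p \<le> card X"
proof -
  \<comment> \<open>With \<open>\<epsilon> = 1\<close> there are at most \<open>3 * k\<close>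
    columns and \<open>k\<close> rows per fan, but at least \<open>k * k\<close> ones; so
    \<open>k \<ge> 3 * K\<close> suffices.\<close>
  define k where "k = 3 * K + 1"
  then have "0 < k" by simp
  obtain X \<Phi> where X: "fan_matrix k X \<Phi>" "\<Phi> \<noteq> {}" "k * k * card \<Phi> \<le> card X"
    "real (card (snd ` X)) \<le> ((1 + 1) * real k + k) * card \<Phi>"
    using fan_matrix_dense[of 1 k k] \<open>0 < k\<close> zero_less_one by blast
  define p where "p = 3 * k * card \<Phi>"
  have "0 < card \<Phi>" using X(2) fan_matrixD(2)[OF X(1)] by (simp add: card_gt_0_iff)
  then have "0 < p" by (simp add: p_def k_def)
  have fin: "finite X" using fan_matrixD(1)[OF X(1)] .
  have "real (card (snd ` X)) \<le> real p" using X(4) by (simp add: p_def algebra_simps)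
  then have cols: "card (snd ` X) \<le> p" by simp
  have rows: "card (fst ` X) \<le> p" using card_rows_fan_matrix_le[OF X(1)] by (simp add: p_def)
  obtain \<sigma> where \<sigma>: "strict_mono_on (fst ` X) \<sigma>" "\<sigma> ` fst ` X \<subseteq> {..<p}"
    using rank_in_finite_set[OF _ rows] fin by auto
  obtain \<tau> where \<tau>: "strict_mono_on (snd ` X) \<tau>" "\<tau> ` snd ` X \<subseteq> {..<p}"
    using rank_in_finite_set[OF _ cols] fin by auto
  note img = abab_free_image[OF fan_matrixD(3)[OF X(1)] \<sigma>(1) \<tau>(1)]
  have "map_prod \<sigma> \<tau> ` X \<subseteq> {..<p} \<times> {..<p}" using \<sigma>(2) \<tau>(2) by (force simp: map_prod_def)
  moreover have "K * p \<le> card (map_prod \<sigma> \<tau> ` X)"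
  proof -
    have "K * p \<le> k * k * card \<Phi>" by (simp add: p_def k_def algebra_simps)
    then show ?thesis using X(3) by (simp add: card_image[OF img(2)])
  qed
  ultimately show ?thesis using \<open>0 < p\<close> img(1) by blast
qed

text \<open>A row determines its block, so \<open>c1\<close> and \<open>c3\<close> lie in the same
  block, and so do \<open>c2\<close> and \<open>c4\<close>. By monotonicity the whole alternation
  stays in one block.\<close>

lemma abab_free_diagonal_blocks:
  fixes p t :: nat
  assumes p: "0 < p" and X: "X \<subseteq> {..<p} \<times> {..<p}" "abab_free X"
  defines "Z \<equiv> (\<lambda>(q, r, c). (q * p + r, q * p + c)) ` ({..<t} \<times> X)"
  shows "abab_free Z" "card Z = t * card X" "Z \<subseteq> {..<t * p} \<times> {..<t * p}"
proof -
  have Z: "r div p = c div p \<and> c div p < t \<and> (r mod p, c mod p) \<in> X" if "(r, c) \<in> Z" for r c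
    using that X(1) p by (auto simp: Z_def)
  show "abab_free Z"
  proof (rule abab_freeI)
    fix a b c1 c2 c3 c4
    assume ab: "a < b" and lt: "c1 < c2" "c2 < c3" "c3 < c4"
      and in_Z: "(a, c1) \<in> Z" "(b, c2) \<in> Z" "(a, c3) \<in> Z" "(b, c4) \<in> Z"
    have le: "c1 div p \<le> c2 div p" "c2 div p \<le> c3 div p" "c3 div p \<le> c4 div p"
      using lt by (simp_all add: div_le_mono)
    then have eq: "c1 div p = c2 div p" "c2 div p = c3 div p" "c3 div p = c4 div p" "a div p = b div p"
      using Z[OF in_Z(1)] Z[OF in_Z(2)] Z[OF in_Z(3)] Z[OF in_Z(4)] by linarith+
    note md = eq[THEN less_iff_mod_less]
    show False
      using abab_freeD[OF X(2), of "a mod p" "b mod p" "c1 mod p" "c2 mod p" "c3 mod p" "c4 mod p"]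
        md ab lt Z[OF in_Z(1)] Z[OF in_Z(2)] Z[OF in_Z(3)] Z[OF in_Z(4)] by blast
  qed
  have "inj_on (\<lambda>(q, r, c). (q * p + r, q * p + c)) ({..<t} \<times> X)"
  proof (rule inj_onI)
    fix u v assume uv: "u \<in> {..<t} \<times> X" "v \<in> {..<t} \<times> X"
      "(case u of (q, r, c) \<Rightarrow> (q * p + r, q * p + c)) = (case v of (q, r, c) \<Rightarrow> (q * p + r, q * p + c))"
    obtain q r c q' r' c' where u: "u = (q, r, c)" "v = (q', r', c')" by (metis surj_pair)
    then have b: "r < p" "r' < p" using uv X by auto
    have eq: "q * p + r = q' * p + r'" "q * p + c = q' * p + c'" using uv u by auto
    have "(q * p + r) div p = q" "(q' * p + r') div p = q'" using b by simp_all
    then have "q = q'" using eq by simp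
    then show "u = v" using eq u by simp
  qed
  then show "card Z = t * card X" by (simp add: Z_def card_image card_cartesian_product)
  have "q * p + r < t * p" if "q < t" "r < p" for q r
  proof -
    have "Suc q * p \<le> t * p" using that by (intro mult_le_mono1) auto
    then show ?thesis using that by simp
  qed
  then show "Z \<subseteq> {..<t * p} \<times> {..<t * p}" using X(1) by (fastforce simp: Z_def)
qed

lemma superlinear_abab_free:
  obtains M where "superlinear M" "\<And>n. abab_free (M n)"
proof -
  define G where "G n = {X. X \<subseteq> {..<n} \<times> {..<n :: nat} \<and> abab_free X}" for n
  have fin: "finite (G n)" for n
    by (rule finite_subset[of _ "Pow ({..<n} \<times> {..<n})"]) (auto simp: G_def)
  have "{} \<in> G n" for n by (simp add: G_def abab_free_def)
  then have "Max (card ` G n) \<in> card ` G n" for n using fin by (intro Max_in) auto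
  then have "\<exists>X\<in>G n. card X = Max (card ` G n)" for n by (metis imageE)
  moreover have "card Y \<le> Max (card ` G n)" if "Y \<in> G n" for n Y using fin that by simp
  ultimately have "\<exists>X\<in>G n. \<forall>Y\<in>G n. card Y \<le> card X" for n by metis
  then obtain M where M: "\<And>n. M n \<in> G n" "\<And>n Y. Y \<in> G n \<Longrightarrow> card Y \<le> card (M n)" by metis
  show thesis
  proof
    show "abab_free (M n)" for n using M(1) by (simp add: G_def)
    show "superlinear M"
      unfolding superlinear_def
    proof (intro conjI allI)
      fix n show "M n \<subseteq> {..<n} \<times> {..<n}" using M(1) by (simp add: G_def)
    next
      fix K :: nat
      \<comment> \<open>The factor 2 compensates for the part of the \<open>n\<close> by
        \<open>n\<close> square that whole blocks of size \<open>p\<close> miss: they cover at least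
        half of the diagonal.\<close>
      obtain p X where X: "0 < p" "X \<subseteq> {..<p} \<times> {..<p}" "abab_free X" "2 * K * p \<le> card X"
        using abab_free_dense by blast
      have "K * n \<le> card (M n)" if "p \<le> n" for n
      proof -
        let ?Z = "(\<lambda>(q, r, c). (q * p + r, q * p + c)) ` ({..<n div p} \<times> X)"
        note Z = abab_free_diagonal_blocks[OF X(1-3), of "n div p"]
        have "n div p * p \<le> n" by simp
        then have sub: "{..<n div p * p} \<subseteq> {..<n}" by simp
        from Z(3) Sigma_mono[OF sub sub] have "?Z \<subseteq> {..<n} \<times> {..<n}" by (rule subset_trans)
        then have "card ?Z \<le> card (M n)" using Z(1) by (intro M(2)) (simp add: G_def)
        moreover have "n \<le> 2 * (n div p * p)"
        proof -
          have "n mod p < p" using X(1) by simp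
          moreover have "p \<le> n div p * p"
            using that X(1) by (metis div_greater_zero_iff mult_le_mono1 nat_mult_1 Suc_leI One_nat_def)
          ultimately show ?thesis using div_mult_mod_eq[of n p] by linarith
        qed
        then have "K * n \<le> K * (2 * (n div p * p))" by (rule mult_le_mono2)
        then have "K * n \<le> n div p * (2 * K * p)" by (simp add: mult_ac)
        moreover have "n div p * (2 * K * p) \<le> n div p * card X" using X(4) by (rule mult_le_mono2)
        ultimately show ?thesis using Z(2) by linarith
      qed
      then show "\<forall>\<^sub>F n in sequentially. K * n \<le> card (M n)"
        unfolding eventually_sequentially by blast
    qed
  qed
qed

text \<open>Only coordinate \<open>i\<close> has to alternate, so \<open>r1\<close> and
  \<open>r3\<close> may be different lines. This matches a transversal, which is examined one
  coordinate at a time.\<close>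

lemma minimally_non_O_abab:
  assumes min: "minimally_non_O (Suc m) Q" and dims: "dims Q = ks @ [j]" and i: "i < m"
    and ones: "r1 @ [c1] \<in> ones Q" "r2 @ [c2] \<in> ones Q" "r3 @ [c3] \<in> ones Q" "r4 @ [c4] \<in> ones Q"
    and eq: "r1 ! i = r3 ! i" "r2 ! i = r4 ! i" and ne: "r1 ! i \<noteq> r2 ! i"
    and c: "c1 < c2" "c2 < c3" "c3 < c4"
  shows "ones Q = {r1 @ [c1], r2 @ [c2], r3 @ [c3], r4 @ [c4]}"
proof -
  obtain M where M: "superlinear M" "\<And>n. abab_free (M n)" using superlinear_abab_free by blast
  define M' where "M' = (if r1 ! i < r2 ! i then M else flip_rows M)"
  have Q: "is_matrix (Suc m) Q" using min by (simp add: minimally_non_O_def)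
  then have pos: "ones Q \<subseteq> positions (ks @ [j])" and m: "length ks = m"
    using dims by (simp_all add: is_matrix_snoc)
  have b: "r1 ! i < ks ! i" "r2 ! i < ks ! i" "c4 < j"
    using snoc_in_positionsD(1,2)[OF pos] ones i m by (auto simp: positions_def)
  have M': "superlinear M'" using M by (simp add: M'_def superlinear_flip_rows)
  show ?thesis
  proof (rule minimally_non_O_ones_eq[OF min dims i M'])
    show "{r1 @ [c1], r2 @ [c2], r3 @ [c3], r4 @ [c4]} \<subseteq> ones Q" using ones by auto
    fix n f g
    assume f: "strict_mono_on {..<ks ! i} f" and g: "strict_mono_on {..<j} g"
      and img: "\<And>r c. r @ [c] \<in> {r1 @ [c1], r2 @ [c2], r3 @ [c3], r4 @ [c4]} \<Longrightarrow> (f (r ! i), g c) \<in> M' n"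
    let ?a = "f (r1 ! i)" and ?b = "f (r2 ! i)"
    have img': "(?a, g c1) \<in> M' n" "(?b, g c2) \<in> M' n" "(?a, g c3) \<in> M' n" "(?b, g c4) \<in> M' n"
      using img[of r1 c1] img[of r2 c2] img[of r3 c3] img[of r4 c4] eq by auto
    have gl: "g c1 < g c2" "g c2 < g c3" "g c3 < g c4"
      using strict_mono_onD[OF g] c b by auto
    show False
    proof (cases "r1 ! i < r2 ! i")
      case True
      then have "?a < ?b" using strict_mono_onD[OF f] b by auto
      then show False using abab_freeD[OF M(2) _ gl] img' True by (simp add: M'_def)
    next
      case False
      then have "?b < ?a" using strict_mono_onD[OF f] b ne by auto
      moreover have "?a < n" "?b < n" using img' False by (auto simp: M'_def flip_rows_def)
      ultimately have lt: "n - 1 - ?a < n - 1 - ?b" by linarith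
      show False using abab_freeD[OF M(2)[of n] lt gl] img' False by (simp add: M'_def flip_rows_def)
    qed
  qed
qed

section \<open>The number of slices\<close>

text \<open>At each change, \<open>w c\<close> occurs for the last time (\<open>A\<close>) or
  \<open>w (Suc c)\<close> for the first time (\<open>B\<close>); otherwise an earlier and a later
  occurrence complete an alternation. The value \<open>w (j - 1)\<close> is missed by
  \<open>A\<close> and \<open>w 0\<close> by \<open>B\<close>, leaving \<open>k - 1\<close> values
  for each.\<close>

lemma card_changes_le:
  fixes w :: "nat \<Rightarrow> nat"
  assumes k: "\<And>c. c < j \<Longrightarrow> w c < k"
    and free: "\<And>c1 c2 c3 c4. c1 < c2 \<Longrightarrow> c2 < c3 \<Longrightarrow> c3 < c4 \<Longrightarrow> c4 < j \<Longrightarrow>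
      w c1 = w c3 \<Longrightarrow> w c2 = w c4 \<Longrightarrow> w c1 = w c2"
  shows "card {c. Suc c < j \<and> w c \<noteq> w (Suc c)} \<le> 2 * k - 2"
proof (cases "j = 0")
  case False
  define A where "A = {c. Suc c < j \<and> (\<forall>c'. c < c' \<and> c' < j \<longrightarrow> w c' \<noteq> w c)}"
  define B where "B = {c. Suc c < j \<and> (\<forall>c'\<le>c. w c' \<noteq> w (Suc c))}"
  have "{c. Suc c < j \<and> w c \<noteq> w (Suc c)} \<subseteq> A \<union> B"
  proof (rule subsetI, rule ccontr)
    fix c assume c: "c \<in> {c. Suc c < j \<and> w c \<noteq> w (Suc c)}" "c \<notin> A \<union> B"
    then have j: "Suc c < j" "w c \<noteq> w (Suc c)" by auto
    obtain c4 where c4: "c < c4" "c4 < j" "w c4 = w c" using c j unfolding A_def by blast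
    obtain c1 where c1: "c1 \<le> c" "w c1 = w (Suc c)" using c j unfolding B_def by blast
    have "c1 \<noteq> c" "Suc c \<noteq> c4" using j c1 c4 by auto
    then have "c1 < c" "Suc c < c4" using c1 c4 by auto
    then show False using free[of c1 c "Suc c" c4] j c1 c4 by auto
  qed
  moreover have fin: "finite A" "finite B"
    by (rule finite_subset[of _ "{..<j}"], auto simp: A_def B_def)+
  ultimately have "card {c. Suc c < j \<and> w c \<noteq> w (Suc c)} \<le> card (A \<union> B)"
    by (intro card_mono) auto
  also have "\<dots> \<le> card A + card B" by (rule card_Un_le)
  finally have "card {c. Suc c < j \<and> w c \<noteq> w (Suc c)} \<le> card A + card B" .
  moreover have "card A \<le> card ({..<k} - {w (j - 1)})"
  proof (rule card_inj_on_le[of w])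
    show "inj_on w A"
    proof (rule inj_onI)
      fix x y assume xy: "x \<in> A" "y \<in> A" "w x = w y"
      have *: "w c \<noteq> w z" if "z \<in> A" "z < c" "c < j" for z c using that unfolding A_def by blast
      have "z < j" if "z \<in> A" for z using that unfolding A_def by simp
      then have "\<not> x < y" "\<not> y < x" using xy * by metis+
      then show "x = y" by linarith
    qed
    show "w ` A \<subseteq> {..<k} - {w (j - 1)}"
    proof (rule image_subsetI)
      fix c assume "c \<in> A"
      then have c: "Suc c < j" "c < j - 1 \<and> j - 1 < j \<longrightarrow> w (j - 1) \<noteq> w c"
        unfolding A_def by blast+
      then have "w (j - 1) \<noteq> w c" by linarith
      then show "w c \<in> {..<k} - {w (j - 1)}" using k[of c] c(1) by simp
    qed
  qed simp
  moreover have "card B \<le> card ({..<k} - {w 0})"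
  proof (rule card_inj_on_le[of "\<lambda>c. w (Suc c)"])
    show "inj_on (\<lambda>c. w (Suc c)) B"
    proof (rule inj_onI)
      fix x y assume xy: "x \<in> B" "y \<in> B" "w (Suc x) = w (Suc y)"
      have "w y' \<noteq> w (Suc z)" if "z \<in> B" "y' \<le> z" for y' z using that unfolding B_def by blast
      then have "\<not> Suc x \<le> y" "\<not> Suc y \<le> x" using xy by metis+
      then show "x = y" by simp
    qed
    show "(\<lambda>c. w (Suc c)) ` B \<subseteq> {..<k} - {w 0}"
    proof (rule image_subsetI)
      fix c assume "c \<in> B"
      then have "Suc c < j" "w 0 \<noteq> w (Suc c)" unfolding B_def by blast+
      then show "w (Suc c) \<in> {..<k} - {w 0}" using k[of "Suc c"] by simp
    qed
  qed simp
  moreover have "w (j - 1) < k" "w 0 < k" using k False by auto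
  ultimately show ?thesis by simp
qed simp

text \<open>Distinct lines differ in some coordinate, to which the planar argument applies. That
  coordinate has at least two values, which makes \<open>S ks\<close> at least five.\<close>

lemma minimally_non_O_two_nonextreme:
  assumes min: "minimally_non_O (Suc m) Q" and dims: "dims Q = ks @ [j]"
    and ones: "r1 @ [c1] \<in> ones Q" "r2 @ [c2] \<in> ones Q" "r1 @ [c] \<in> ones Q" "r2 @ [c] \<in> ones Q"
    and ne: "r1 \<noteq> r2" and c: "c1 < c \<and> c2 < c \<or> c < c1 \<and> c < c2"
  shows "ones Q = {r1 @ [c1], r2 @ [c2], r1 @ [c], r2 @ [c]}"
    and "\<exists>i<length ks. 2 \<le> ks ! i"
proof -
  have Q: "is_matrix (Suc m) Q" using min by (simp add: minimally_non_O_def)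
  then have pos: "ones Q \<subseteq> positions (ks @ [j])" and m: "length ks = m"
    using dims by (simp_all add: is_matrix_snoc)
  have r: "r1 \<in> positions ks" "r2 \<in> positions ks" using snoc_in_positionsD(1)[OF pos] ones by auto
  then have "length r1 = length r2" by (simp add: positions_def)
  then obtain i where i: "i < m" "r1 ! i \<noteq> r2 ! i"
    using ne nth_equalityI[of r1 r2] r m by (auto simp: positions_def)
  show "ones Q = {r1 @ [c1], r2 @ [c2], r1 @ [c], r2 @ [c]}"
    by (rule minimally_non_O_two_rows[OF min dims i(1) ones i(2) c])
  have "r1 ! i < ks ! i" "r2 ! i < ks ! i" using r i m by (auto simp: positions_def)
  then have "2 \<le> ks ! i" using i(2) by linarith
  then show "\<exists>i<length ks. 2 \<le> ks ! i" using i m by auto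
qed

lemma S_ge: "i < length ks \<Longrightarrow> 2 \<le> ks ! i \<Longrightarrow> 5 \<le> S ks"
proof -
  assume i: "i < length ks" "2 \<le> ks ! i"
  have "2 * ks ! i - 2 \<le> (\<Sum>i<length ks. 2 * ks ! i - 2)"
    using i by (intro member_le_sum) auto
  then show ?thesis using i by (simp add: S_def)
qed

text \<open>A transversal choosing one row per slice, and whenever possible a row which has no other one,
  never stays put twice in a row. It moves only boundedly often in each coordinate, as each
  coordinate of it is free of \<open>abab\<close>.\<close>

lemma minimally_non_O_last_dim_le:
  assumes min: "minimally_non_O (Suc m) Q" and dims: "dims Q = ks @ [j]"
  shows "j \<le> S ks"
proof (rule ccontr)
  assume gt: "\<not> ?thesis"
  have Q: "is_matrix (Suc m) Q" using min by (simp add: minimally_non_O_def)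
  then have pos: "ones Q \<subseteq> positions (ks @ [j])" and m: "length ks = m"
    using dims by (simp_all add: is_matrix_snoc)
  note posD = snoc_in_positionsD[OF pos]
  have nonempty: "\<exists>r. r @ [c] \<in> ones Q" if "c < j" for c
    by (rule minimally_non_O_slice_nonempty[OF min dims that])
  \<comment> \<open>As every slice contains a one, the exceptional matrices with four ones have at
    most four slices, too few for the assumed \<open>S ks < j\<close>.\<close>
  have small: "j \<le> card F" if "ones Q = F" "finite F" for F
  proof -
    have "{..<j} \<subseteq> last ` F"
    proof
      fix c assume "c \<in> {..<j}"
      then obtain r where "r @ [c] \<in> F" using nonempty \<open>ones Q = F\<close> by blast
      then show "c \<in> last ` F" by (metis image_eqI last_snoc)
    qed
    then have "card {..<j} \<le> card (last ` F)" using that by (intro card_mono) auto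
    also have "\<dots> \<le> card F" by (rule card_image_le[OF that(2)])
    finally show ?thesis by simp
  qed
  have four: "card {a, b, c, d} \<le> 4" for a b c d :: "nat list"
    using card_length[of "[a, b, c, d]"] by simp
  have nonextreme: "r1 = r2"
    if "r1 @ [c1] \<in> ones Q" "r2 @ [c2] \<in> ones Q" "r1 @ [c] \<in> ones Q" "r2 @ [c] \<in> ones Q"
      "c1 < c \<and> c2 < c \<or> c < c1 \<and> c < c2" for r1 r2 c1 c2 c
  proof (rule ccontr)
    assume "r1 \<noteq> r2"
    note * = minimally_non_O_two_nonextreme[OF min dims that(1-4) this that(5)]
    have "j \<le> 4" using small[OF *(1)] four by (meson finite.emptyI finite.insertI le_trans)
    moreover have "5 \<le> S ks" using *(2) S_ge by blast
    ultimately show False using gt by simp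
  qed
  have abab: "r1 ! i = r2 ! i"
    if "i < m" "r1 @ [c1] \<in> ones Q" "r2 @ [c2] \<in> ones Q" "r3 @ [c3] \<in> ones Q" "r4 @ [c4] \<in> ones Q"
      "r1 ! i = r3 ! i" "r2 ! i = r4 ! i" "c1 < c2" "c2 < c3" "c3 < c4" for i r1 r2 r3 r4 c1 c2 c3 c4
  proof (rule ccontr)
    assume ne: "r1 ! i \<noteq> r2 ! i"
    have "j \<le> 4"
      using small[OF minimally_non_O_abab[OF min dims that(1-7) ne that(8-10)]] four
      by (meson finite.emptyI finite.insertI le_trans)
    moreover have "r1 ! i < ks ! i" "r2 ! i < ks ! i"
      using posD(1) that m by (auto simp: positions_def)
    then have "2 \<le> ks ! i" using ne by linarith
    then have "5 \<le> S ks" using S_ge that(1) m by blast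
    ultimately show False using gt by simp
  qed
  define alone where "alone r c \<longleftrightarrow> r @ [c] \<in> ones Q \<and> (\<forall>c'. r @ [c'] \<in> ones Q \<longrightarrow> c' = c)" for r c
  have "\<exists>r. r @ [c] \<in> ones Q \<and> ((\<exists>r'. alone r' c) \<longrightarrow> alone r c)" if "c < j" for c
    using nonempty[OF that] by (auto simp: alone_def)
  then obtain \<rho> where \<rho>: "\<And>c. c < j \<Longrightarrow> \<rho> c @ [c] \<in> ones Q"
    "\<And>c r. c < j \<Longrightarrow> alone r c \<Longrightarrow> alone (\<rho> c) c" by metis
  \<comment> \<open>Otherwise slice \<open>c\<close> has a one on another line \<open>r\<close>. By
    \<open>nonextreme\<close>, \<open>r\<close> has no one elsewhere, so \<open>\<rho>\<close>
    should have chosen such a line, whereas \<open>\<rho> c\<close> continues to the next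
    slice.\<close>
  have stay: "0 < c \<and> \<rho> (c - 1) \<noteq> \<rho> c" if c: "Suc c < j" "\<rho> c = \<rho> (Suc c)" for c
  proof (rule ccontr)
    assume "\<not> ?thesis"
    then have c0: "c = 0 \<or> \<rho> (c - 1) = \<rho> c" by auto
    have up: "\<rho> c @ [Suc c] \<in> ones Q" using \<rho>(1)[OF c(1)] c(2) by simp
    have "c - 1 < j" using c(1) by linarith
    then have down: "c = 0 \<or> \<rho> c @ [c - 1] \<in> ones Q" using c0 \<rho>(1)[of "c - 1"] by auto
    obtain r where r: "r \<noteq> \<rho> c" "r @ [c] \<in> ones Q"
      using minimally_non_O_not_lonely[OF min dims up down] by blast
    have "c' = c" if c': "r @ [c'] \<in> ones Q" for c'
    proof (rule ccontr)
      assume "c' \<noteq> c"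
      then consider "c < c'" | "c' < c" by linarith
      then show False
      proof cases
        case 1
        then show False using nonextreme[OF c' up r(2) \<rho>(1)] r(1) c(1) by auto
      next
        case 2
        then have down': "\<rho> c @ [c - 1] \<in> ones Q" "c - 1 < c" using down by auto
        show False using nonextreme[OF c' down'(1) r(2) \<rho>(1)] down'(2) 2 r(1) c(1) by auto
      qed
    qed
    then have "alone r c" using r(2) unfolding alone_def by blast
    then have "alone (\<rho> c) c" using \<rho>(2) c(1) by simp
    then have "Suc c = c" using up unfolding alone_def by blast
    then show False by simp
  qed
  define D where "D = {c. Suc c < j \<and> \<rho> c \<noteq> \<rho> (Suc c)}"
  have "finite D" by (rule finite_subset[of _ "{..<j}"]) (auto simp: D_def)
  \<comment> \<open>Each of the \<open>j - 1\<close> steps is a move or directly follows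
    one.\<close>
  have "{..<j - 1} \<subseteq> D \<union> Suc ` D"
  proof
    fix c assume "c \<in> {..<j - 1}"
    then have c: "Suc c < j" by simp
    show "c \<in> D \<union> Suc ` D"
    proof (cases "\<rho> c = \<rho> (Suc c)")
      case True
      then have "0 < c" "\<rho> (c - 1) \<noteq> \<rho> c" using stay[OF c] by auto
      then have "c - 1 \<in> D" "c = Suc (c - 1)" using c by (auto simp: D_def)
      then show ?thesis by blast
    qed (use c in \<open>simp add: D_def\<close>)
  qed
  then have "card {..<j - 1} \<le> card (D \<union> Suc ` D)" using \<open>finite D\<close> by (intro card_mono) auto
  also have "\<dots> \<le> card D + card (Suc ` D)" by (rule card_Un_le)
  finally have j: "j \<le> 1 + 2 * card D" by (simp add: card_image)
  define D' where "D' i = {c. Suc c < j \<and> \<rho> c ! i \<noteq> \<rho> (Suc c) ! i}" for i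
  have fin: "finite (D' i)" for i by (rule finite_subset[of _ "{..<j}"]) (auto simp: D'_def)
  have "D \<subseteq> (\<Union>i<m. D' i)"
  proof
    fix c assume c: "c \<in> D"
    then have "length (\<rho> c) = m" "length (\<rho> (Suc c)) = m"
      using posD(3)[OF \<rho>(1)[of c]] posD(3)[OF \<rho>(1)[of "Suc c"]] m by (auto simp: D_def)
    then obtain i where "i < m" "\<rho> c ! i \<noteq> \<rho> (Suc c) ! i"
      using c nth_equalityI[of "\<rho> c" "\<rho> (Suc c)"] by (auto simp: D_def)
    then show "c \<in> (\<Union>i<m. D' i)" using c by (auto simp: D'_def D_def)
  qed
  then have "card D \<le> card (\<Union>i<m. D' i)" using fin by (intro card_mono) auto
  also have "\<dots> \<le> (\<Sum>i<m. card (D' i))" by (rule card_UN_le) simp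
  also have "\<dots> \<le> (\<Sum>i<m. 2 * ks ! i - 2)"
  proof (rule sum_mono)
    fix i assume "i \<in> {..<m}"
    then have i: "i < m" by simp
    show "card (D' i) \<le> 2 * ks ! i - 2"
      unfolding D'_def
    proof (rule card_changes_le)
      show "\<rho> c ! i < ks ! i" if "c < j" for c
        using posD(1)[OF \<rho>(1)[OF that]] i m by (simp add: positions_def)
      show "\<rho> c1 ! i = \<rho> c2 ! i"
        if c: "c1 < c2" "c2 < c3" "c3 < c4" "c4 < j" "\<rho> c1 ! i = \<rho> c3 ! i" "\<rho> c2 ! i = \<rho> c4 ! i"
        for c1 c2 c3 c4
        using abab[OF i \<rho>(1) \<rho>(1) \<rho>(1) \<rho>(1) c(5,6,1-3)] c by simp
    qed
  qed
  finally have "card D \<le> (\<Sum>i<m. 2 * ks ! i - 2)" .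
  then show False using j gt by (simp add: S_def m)
qed

section \<open>Counting\<close>

text \<open>\<open>R\<close> indexes the lines in the last direction; the last condition limits each slice to a
  single one that is not the first on its line.\<close>

definition sparse_slices :: "'a set \<Rightarrow> nat \<Rightarrow> ('a \<times> nat) set set" where
  "sparse_slices R j = {X. X \<subseteq> R \<times> {..<j} \<and> (\<forall>c<j. \<exists>r. (r, c) \<in> X) \<and>
     (\<forall>r r' c c1 c2. (r, c1) \<in> X \<longrightarrow> (r', c2) \<in> X \<longrightarrow> (r, c) \<in> X \<longrightarrow> (r', c) \<in> X \<longrightarrow>
        c1 < c \<longrightarrow> c2 < c \<longrightarrow> r = r')}"

lemma finite_sparse_slices: "finite R \<Longrightarrow> finite (sparse_slices R j)"
  by (rule finite_subset[of _ "Pow (R \<times> {..<j})"]) (auto simp: sparse_slices_def)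

text \<open>In the code, \<open>f X\<close> gives the first one of each line, with \<open>j\<close>
  for an empty line. For each slice after the first, \<open>g X\<close> gives the line whose one
  there is not its first, if it exists, and any line of the slice otherwise.\<close>

lemma card_sparse_slices_le:
  assumes R: "finite R" and j: "0 < j"
  shows "card (sparse_slices R j) \<le> ((j + 1) ^ card R - j ^ card R) * card R ^ (j - 1)"
proof -
  define f where "f X = restrict (\<lambda>r. if \<exists>c. (r, c) \<in> X then LEAST c. (r, c) \<in> X else j) R"
    for X :: "('a \<times> nat) set"
  define nf where "nf X c r \<longleftrightarrow> (r, c) \<in> X \<and> (\<exists>c'<c. (r, c') \<in> X)" for X :: "('a \<times> nat) set" and c r
  define g where "g X = restrict (\<lambda>c. SOME r. (r, c) \<in> X \<and> ((\<exists>r'. nf X c r') \<longrightarrow> nf X c r)) {1..<j}"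
    for X :: "('a \<times> nat) set"
  \<comment> \<open>The condition \<open>f r < c\<close> suppresses the arbitrary choices of
    \<open>g\<close>: a line chosen for want of a non-first one starts in that slice.\<close>
  define dec where "dec = (\<lambda>(f, g). {(r, c). r \<in> R \<and> c < j \<and> (f r = c \<or> f r < c \<and> g c = r)})"
  let ?T = "((R \<rightarrow>\<^sub>E {..j}) - (R \<rightarrow>\<^sub>E {1..j})) \<times> ({1..<j} \<rightarrow>\<^sub>E R)"
  have sub: "r \<in> R \<and> c < j" if "X \<in> sparse_slices R j" "(r, c) \<in> X" for X r c
    using that by (auto simp: sparse_slices_def)
  have g: "(g X c, c) \<in> X \<and> ((\<exists>r'. nf X c r') \<longrightarrow> nf X c (g X c))"
    if X: "X \<in> sparse_slices R j" and c: "1 \<le> c" "c < j" for X c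
  proof -
    have "\<exists>r. (r, c) \<in> X" using X c by (simp add: sparse_slices_def)
    then have "\<exists>r. (r, c) \<in> X \<and> ((\<exists>r'. nf X c r') \<longrightarrow> nf X c r)" by (auto simp: nf_def)
    from someI_ex[OF this] show ?thesis using c by (simp add: g_def)
  qed
  have f_le: "f X r \<le> c \<and> (r, f X r) \<in> X" if X: "X \<in> sparse_slices R j" "(r, c) \<in> X" for X r c
    using sub[OF X] X(2) LeastI[of "\<lambda>c. (r, c) \<in> X" c] Least_le[of "\<lambda>c. (r, c) \<in> X" c]
    by (auto simp: f_def)
  have f_in: "(r, f X r) \<in> X" if "r \<in> R" "f X r < j" for X r
    using that by (auto simp: f_def intro: LeastI split: if_splits)
  have uniq: "r = r'" if "X \<in> sparse_slices R j" "nf X c r" "nf X c r'" for X c r r'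
    using that unfolding sparse_slices_def nf_def by blast
  have "dec (f X, g X) = X" if X: "X \<in> sparse_slices R j" for X
  proof (rule set_eqI, clarify)
    fix r c
    show "(r, c) \<in> dec (f X, g X) \<longleftrightarrow> (r, c) \<in> X"
    proof
      assume "(r, c) \<in> X"
      then have r: "r \<in> R" "c < j" "f X r \<le> c" "(r, f X r) \<in> X" using sub[OF X] f_le[OF X] by auto
      have "g X c = r" if "f X r < c"
      proof -
        have "nf X c r" using r(4) that \<open>(r, c) \<in> X\<close> by (auto simp: nf_def)
        moreover from this have "nf X c (g X c)" using g[OF X, of c] r(2) that by auto
        ultimately show ?thesis using uniq[OF X] by blast
      qed
      then show "(r, c) \<in> dec (f X, g X)" using r by (auto simp: dec_def)
    next
      assume "(r, c) \<in> dec (f X, g X)"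
      then have "r \<in> R" "c < j" "f X r = c \<or> f X r < c \<and> g X c = r" by (auto simp: dec_def)
      then show "(r, c) \<in> X" using f_in[of r X] g[OF X, of c] by auto
    qed
  qed
  then have "inj_on (\<lambda>X. (f X, g X)) (sparse_slices R j)"
    by (rule inj_on_inverseI)
  moreover have "(\<lambda>X. (f X, g X)) ` sparse_slices R j \<subseteq> ?T"
  proof (rule image_subsetI)
    fix X assume X: "X \<in> sparse_slices R j"
    obtain r0 where r0: "(r0, 0) \<in> X" using X j by (auto simp: sparse_slices_def)
    then have "r0 \<in> R" "f X r0 = 0" using sub[OF X] f_le[OF X] by auto
    then have "f X \<notin> R \<rightarrow>\<^sub>E {1..j}" by (auto dest!: PiE_mem)
    moreover have "f X r \<le> j" if "r \<in> R" for r
    proof (cases "\<exists>c. (r, c) \<in> X")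
      case True
      then obtain c where "(r, c) \<in> X" by blast
      then show ?thesis using f_le[OF X, of r c] sub[OF X] by fastforce
    qed (use that in \<open>simp add: f_def\<close>)
    then have "f X \<in> R \<rightarrow>\<^sub>E {..j}" by (auto simp: PiE_iff f_def)
    moreover have "g X \<in> {1..<j} \<rightarrow>\<^sub>E R"
    proof (rule PiE_I)
      show "g X c \<in> R" if "c \<in> {1..<j}" for c
        using g[OF X, of c] sub[OF X, of "g X c" c] that by simp
    qed (auto simp: g_def)
    ultimately show "(f X, g X) \<in> ?T" by simp
  qed
  moreover have "finite ?T" using R by (intro finite_cartesian_product finite_Diff finite_PiE) auto
  ultimately have "card (sparse_slices R j) \<le> card ?T" by (rule card_inj_on_le)
  also have "card ?T = card ((R \<rightarrow>\<^sub>E {..j}) - (R \<rightarrow>\<^sub>E {1..j})) * card R ^ (j - 1)"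
    by (simp add: card_cartesian_product card_funcsetE)
  also have "card ((R \<rightarrow>\<^sub>E {..j}) - (R \<rightarrow>\<^sub>E {1..j})) = (j + 1) ^ card R - j ^ card R"
  proof -
    have "R \<rightarrow>\<^sub>E {1..j} \<subseteq> R \<rightarrow>\<^sub>E {..j}" by (intro PiE_mono) auto
    then show ?thesis
      using R by (subst card_Diff_subset) (auto simp: card_funcsetE intro!: finite_PiE)
  qed
  finally show ?thesis .
qed

section \<open>Codes of minimal matrices\<close>

definition line_slices :: "zo_matrix \<Rightarrow> (nat list \<times> nat) set" where
  "line_slices Q = {(r, c). r @ [c] \<in> ones Q}"

lemma in_line_slices [simp]: "(r, c) \<in> line_slices Q \<longleftrightarrow> r @ [c] \<in> ones Q"
  by (simp add: line_slices_def)

lemma line_slices_mono: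
  assumes "is_matrix (Suc m) Q" "line_slices Q \<subseteq> line_slices Q'"
  shows "ones Q \<subseteq> ones Q'"
proof
  fix x assume x: "x \<in> ones Q"
  then have "length x = Suc m" using assms(1) by (auto simp: is_matrix_def positions_def)
  then obtain r c where "x = r @ [c]" by (cases x rule: rev_cases) auto
  then show "x \<in> ones Q'" using assms(2) x by (auto simp: line_slices_def)
qed

text \<open>A minimal matrix with two ones in a slice that are not the first on their lines has only
  four ones. It is replaced by the matrix with one of them removed, which is no longer
  non-\<open>O(n^(d-1))\<close> and thus does not collide with the code of another minimal matrix.\<close>

lemma minimally_non_O_sparse_code:
  assumes min: "minimally_non_O (Suc m) Q" and dims: "dims Q = ks @ [j]"
    and dense: "line_slices Q \<notin> sparse_slices (positions ks) j"
  shows "\<exists>Y. Y \<in> sparse_slices (positions ks) j \<and> Y \<subset> line_slices Q \<and>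
    line_slices Q = Y \<union> fst ` Y \<times> {j - 1}"
proof -
  have Q: "is_matrix (Suc m) Q" using min by (simp add: minimally_non_O_def)
  then have pos: "ones Q \<subseteq> positions (ks @ [j])" using dims by (simp add: is_matrix_snoc)
  have sub: "line_slices Q \<subseteq> positions ks \<times> {..<j}"
    using snoc_in_positionsD(1,2)[OF pos] by auto
  have nonempty: "\<exists>r. r @ [c] \<in> ones Q" if "c < j" for c
    by (rule minimally_non_O_slice_nonempty[OF min dims that])
  obtain r1 r2 c c1 c2 where r: "r1 @ [c1] \<in> ones Q" "r2 @ [c2] \<in> ones Q" "r1 @ [c] \<in> ones Q" "r2 @ [c] \<in> ones Q"
    and lt: "c1 < c" "c2 < c" and ne: "r1 \<noteq> r2"
    using dense sub nonempty unfolding sparse_slices_def in_line_slices mem_Collect_eq by blast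
  have ones: "ones Q = {r1 @ [c1], r2 @ [c2], r1 @ [c], r2 @ [c]}"
    using minimally_non_O_two_nonextreme(1)[OF min dims r ne] lt by blast
  then have Q_eq: "line_slices Q = {(r1, c1), (r2, c2), (r1, c), (r2, c)}"
    by (auto simp: line_slices_def)
  have "c < j" using snoc_in_positionsD(2)[OF pos r(3)] .
  then obtain r where "r @ [j - 1] \<in> ones Q" using nonempty[of "j - 1"] by auto
  then have "j - 1 = c" using ones lt \<open>c < j\<close> by auto
  \<comment> \<open>Of the two ones in the last slice, that of \<open>r1\<close> is removed. Since
    \<open>r1\<close> keeps its one at \<open>c1\<close>, filling the last slice on all lines of
    \<open>Y\<close> restores it.\<close>
  define Y where "Y = {(r1, c1), (r2, c2), (r2, c)}"
  have "Y \<in> sparse_slices (positions ks) j"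
    unfolding sparse_slices_def
  proof (intro CollectI conjI allI impI)
    show "Y \<subseteq> positions ks \<times> {..<j}" using sub by (auto simp: Y_def Q_eq)
    show "\<exists>r. (r, c') \<in> Y" if c': "c' < j" for c'
      using nonempty[OF c'] by (auto simp: ones Y_def)
  qed (use lt ne in \<open>auto simp: Y_def\<close>)
  moreover have "Y \<subset> line_slices Q" using lt ne by (auto simp: Y_def Q_eq)
  moreover have "line_slices Q = Y \<union> fst ` Y \<times> {j - 1}"
    unfolding \<open>j - 1 = c\<close> by (auto simp: Y_def Q_eq)
  ultimately show ?thesis by blast
qed

theorem theorem3p22:
  fixes d :: nat and ks :: "nat list"
  assumes "d \<ge> 1" and "length ks = d - 1" and "\<forall>k \<in> set ks. k \<ge> 1"
  shows "finite {Q. minimally_non_O d Q \<and> take (d - 1) (dims Q) = ks} \<and>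
         card {Q. minimally_non_O d Q \<and> take (d - 1) (dims Q) = ks}
           \<le> (\<Sum>j = 1..S ks. ((j + 1) ^ P ks - j ^ P ks) * P ks ^ (j - 1))"
proof -
  obtain m where d: "d = Suc m" using assms(1) by (cases d) auto
  let ?M = "{Q. minimally_non_O d Q \<and> take (d - 1) (dims Q) = ks}"
  let ?G = "sparse_slices (positions ks)"
  define len where "len Q = last (dims Q)" for Q
  have min: "minimally_non_O (Suc m) Q" and mat: "is_matrix (Suc m) Q"
    and dims: "dims Q = ks @ [len Q]" if "Q \<in> ?M" for Q
  proof -
    show min: "minimally_non_O (Suc m) Q" using that d by simp
    then show "is_matrix (Suc m) Q" by (simp add: minimally_non_O_def)
    then have "length (dims Q) = Suc m" by (simp add: is_matrix_def)
    then have "dims Q \<noteq> []" "take m (dims Q) = butlast (dims Q)" by (auto simp: butlast_conv_take)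
    then show "dims Q = ks @ [len Q]" using that d append_butlast_last_id[of "dims Q"] by (simp add: len_def)
  qed
  define code where "code Q = (if line_slices Q \<in> ?G (len Q) then line_slices Q
    else SOME Y. Y \<in> ?G (len Q) \<and> Y \<subset> line_slices Q \<and> line_slices Q = Y \<union> fst ` Y \<times> {len Q - 1})"
    for Q
  have code: "code Q \<in> ?G (len Q)"
    "line_slices Q \<notin> ?G (len Q) \<Longrightarrow> code Q \<subset> line_slices Q"
    "line_slices Q \<notin> ?G (len Q) \<Longrightarrow> line_slices Q = code Q \<union> fst ` code Q \<times> {len Q - 1}"
    if "Q \<in> ?M" for Q
    using someI_ex[OF minimally_non_O_sparse_code[OF min[OF that] dims[OF that]]]
    by (auto simp: code_def)
  have no_sub: "\<not> line_slices Q \<subset> line_slices Q'" if "Q \<in> ?M" "Q' \<in> ?M" "len Q = len Q'" for Q Q'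
  proof
    assume s: "line_slices Q \<subset> line_slices Q'"
    then have sub: "ones Q \<subseteq> ones Q'" using line_slices_mono[OF mat[OF that(1)]] by blast
    have "dims Q = dims Q'" using dims[OF that(1)] dims[OF that(2)] that(3) by simp
    then have "contains Q' Q"
      using embeds_id[of Q Q'] sub contains_iff_embeds[of Q' Q] mat[OF that(1)]
      by (auto simp: is_matrix_def)
    then show False
      using not_minimally_non_O_of_contained[OF min[OF that(2)] mat[OF that(1)]] min[OF that(1)] s
      by auto
  qed
  have "inj_on (\<lambda>Q. (len Q, code Q)) ?M"
  proof (rule inj_onI)
    fix Q Q' assume Q: "Q \<in> ?M" "Q' \<in> ?M" and "(len Q, code Q) = (len Q', code Q')"
    then have eq: "len Q = len Q'" "code Q = code Q'" by auto
    \<comment> \<open>Two replaced codes are undone by the same formula. A replaced code equal to an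
      original one would make one minimal matrix a proper part of another, against
      \<open>no_sub\<close>.\<close>
    have "line_slices Q = line_slices Q'"
    proof (cases "line_slices Q \<in> ?G (len Q)"; cases "line_slices Q' \<in> ?G (len Q')")
      assume "line_slices Q \<notin> ?G (len Q)" "line_slices Q' \<notin> ?G (len Q')"
      then show ?thesis using code(3)[OF Q(1)] code(3)[OF Q(2)] eq by metis
    next
      assume *: "line_slices Q \<in> ?G (len Q)" "line_slices Q' \<notin> ?G (len Q')"
      then have "line_slices Q \<subset> line_slices Q'" using code(2)[OF Q(2)] eq by (simp add: code_def)
      then show ?thesis using no_sub[OF Q eq(1)] by blast
    next
      assume *: "line_slices Q \<notin> ?G (len Q)" "line_slices Q' \<in> ?G (len Q')"
      then have "line_slices Q' \<subset> line_slices Q" using code(2)[OF Q(1)] eq by (simp add: code_def)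
      then show ?thesis using no_sub[OF Q(2,1)] eq by simp
    qed (use eq in \<open>simp add: code_def\<close>)
    then have "ones Q = ones Q'"
      using line_slices_mono[OF mat[OF Q(1)]] line_slices_mono[OF mat[OF Q(2)]] by blast
    moreover have "dims Q = dims Q'" using dims[OF Q(1)] dims[OF Q(2)] eq by simp
    ultimately show "Q = Q'" by (intro zo_matrix.expand conjI)
  qed
  moreover have "(\<lambda>Q. (len Q, code Q)) ` ?M \<subseteq> (SIGMA j:{1..S ks}. ?G j)"
  proof (rule image_subsetI)
    fix Q assume Q: "Q \<in> ?M"
    have "0 < len Q" using mat[OF Q] dims[OF Q] by (simp add: is_matrix_snoc)
    moreover have "len Q \<le> S ks" by (rule minimally_non_O_last_dim_le[OF min[OF Q] dims[OF Q]])
    ultimately show "(len Q, code Q) \<in> (SIGMA j:{1..S ks}. ?G j)" using code(1)[OF Q] by simp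
  qed
  moreover have fin: "finite (SIGMA j:{1..S ks}. ?G j)" by (simp add: finite_sparse_slices)
  ultimately have M: "finite ?M" "card ?M \<le> card (SIGMA j:{1..S ks}. ?G j)"
    by (rule inj_on_finite, rule card_inj_on_le)
  note M(2)
  also have "card (SIGMA j:{1..S ks}. ?G j) = (\<Sum>j = 1..S ks. card (?G j))"
    by (simp add: card_SigmaI finite_sparse_slices)
  also have "\<dots> \<le> (\<Sum>j = 1..S ks. ((j + 1) ^ P ks - j ^ P ks) * P ks ^ (j - 1))"
  proof (rule sum_mono)
    fix j assume "j \<in> {1..S ks}"
    then show "card (?G j) \<le> ((j + 1) ^ P ks - j ^ P ks) * P ks ^ (j - 1)"
      using card_sparse_slices_le[of "positions ks" j] by (simp add: P_def card_positions)
  qed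
  finally show ?thesis using M(1) by simp
qed

end
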